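(* Let $\mathfrak g$ be an affine Kac--Moody algebra not of type $A_{2n}^{(2)}$, and let $\ell$ be a nonnegative integer. Let $\sim$ be the sieving equivalence relation on the set $P^+_{\mathrm{cl},\ell}$ of classical dominant integral weights of level $\ell$. Then $$\mathrm{DR}(P^+_{\mathrm{cl},\ell})=\{(\ell-1)\Lambda_0+\Lambda_i : i\in J_{\mathfrak g}\}$$ is a complete set of pairwise inequivalent representatives of $P^+_{\mathrm{cl},\ell}/\!\sim$, the set of equivalence classes of $P^+_{\mathrm{cl},\ell}$ under the sieving equivalence relation. In particular, the number of equivalence classes is $|P_0/Q_0|$, where $P_0$ and $Q_0$ are the weight lattice and root lattice of the finite-dimensional subalgebra $\mathfrak g_0$.
   Context: Let $I=\{0,\dots,n\}$, with simple roots $\alpha_i$, simple coroots $h_i$, fundamental weights $\Lambda_i$, affine Cartan matrix $(\mathsf a_{ij})$, $\langle h_i,\alpha_j\rangle=\mathsf a_{ij}$, $\langle h_j,\Lambda_i\rangle=\delta_{ij}$, null root $\delta=\sum a_i\alpha_i$, canonical central element $c=\sum a_i^\vee h_i$, weight lattice $P=\bigoplus\mathbb Z\Lambda_i\oplus\mathbb Z\delta$, root lattice $Q=\bigoplus\mathbb Z\alpha_i$. The set $P^+_{\mathrm{cl},\ell}$ is the set of dominant integral weights of level $\ell$ modulo $\mathbb Z\delta$, identified with $\{\sum_{i\in I} m_i\Lambda_i:m_i\in\mathbb Z_{\ge0},\ \sum a_i^\vee m_i=\ell\}$. The symmetric form on $\mathfrak h^*$ satisfies $(\Lambda_0|\Lambda_0)=0$,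 $(\alpha_i|\alpha_j)=a_i^\vee a_i^{-1}\mathsf a_{ij}$, $(\alpha_i|\Lambda_0)=\delta_{i0}a_0^{-1}$. The orthogonal projection $\mathfrak h^*\to\mathfrak h_0^*$ (where $\mathfrak h_0$ is spanned by $h_1,\dots,h_n$) is $\overline\mu=\mu-\langle c,\mu\rangle\Lambda_0-(\mu|\Lambda_0)\delta$; $\overline Q$ is the image of $Q$. With $\theta=\delta-a_0\alpha_0$, put $\ell\mathcal C_{\mathrm{af}}=\{\mu\in\mathfrak h_0^*:\langle h_i,\mu\rangle\ge0\ (1\le i\le n),\ (\mu|\theta)\le\ell\}$. The sieving equivalence relation is: $\Lambda\sim\Lambda'$ iff $\ell\mathcal C_{\mathrm{af}}\cap(\overline\Lambda+\overline Q)=\ell\mathcal C_{\mathrm{af}}\cap(\overline{\Lambda'}+\overline Q)$. $\mathfrak g_0$ is the finite-dimensional simple Lie algebra obtained by deleting index $0$ ($P_0$ is spanned over $\mathbb Z$ by $\overline{\Lambda_1},\dots,\overline{\Lambda_n}$ and $Q_0$ by $\overline{\alpha_1},\dots,\overline{\alpha_n}$). Labelling is standard (Kac), with Bourbaki labelling of $\mathfrak g_0$ for $E_6$ ($0$ attached to $2$) and $E_7$ ($0$ attached to $1$); $\mathfrak g_0$ is $B_n$ for $B_n^{(1)},D_{n+1}^{(2)}$ and $C_n$ for $C_n^{(1)},A_{2n-1}^{(2)}$. The index sets are: $J_{\mathfrak g}=\{0,\dots,n\}$ for $A_n^{(1)}$; $\{0,n\}$ for $B_n^{(1)},D_{n+1}^{(2)},E_7^{(1)}$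 (with $n=7$ for $E_7^{(1)}$); $\{0,1\}$ for $C_n^{(1)},A_{2n-1}^{(2)}$; $\{0,1,n-1,n\}$ for $D_n^{(1)}$; $\{0,1,6\}$ for $E_6^{(1)}$; $\{0\}$ (so $\mathrm{DR}(P^+_{\mathrm{cl},\ell})=\{\ell\Lambda_0\}$) for $F_4^{(1)},E_6^{(2)},G_2^{(1)},D_4^{(3)},E_8^{(1)}$.
   Formalization: The level ℓ is assumed to be at least 1 unless J_g = {0}: for ℓ = 0 and J_g ≠ {0} the claim fails, since P^+_{cl,0} = {0} has one class while -Λ_0+Λ_i is not dominant and |P_0/Q_0| > 1. *)

theory Defs
  imports Complex_Main
begin

(* Constructors carry the rank n of the finite part, i.e. the index set is {0..n}:
   Aff_A n is A_n^(1), Aff_B n is B_n^(1), and so on;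
   Tw_A_even n is A_{2n}^(2), Tw_A_odd n is A_{2n-1}^(2), Tw_D n is D_{n+1}^(2),
   Tw_E6 is E_6^(2) and Tw_D4 is D_4^(3). *)
datatype affine_type =
    Aff_A nat | Aff_B nat | Aff_C nat | Aff_D nat
  | Aff_E6 | Aff_E7 | Aff_E8 | Aff_F4 | Aff_G2
  | Tw_A_even nat | Tw_A_odd nat | Tw_D nat | Tw_E6 | Tw_D4

fun rank :: "affine_type \<Rightarrow> nat" where
  "rank (Aff_A n) = n"
| "rank (Aff_B n) = n"
| "rank (Aff_C n) = n"
| "rank (Aff_D n) = n"
| "rank Aff_E6 = 6"
| "rank Aff_E7 = 7"
| "rank Aff_E8 = 8"
| "rank Aff_F4 = 4"
| "rank Aff_G2 = 2"
| "rank (Tw_A_even n) = n"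
| "rank (Tw_A_odd n) = n"
| "rank (Tw_D n) = n"
| "rank Tw_E6 = 4"
| "rank Tw_D4 = 2"

text \<open>The rank bounds of Kac's tables, under which every affine Cartan matrix occurs exactly once.\<close>

fun valid_type :: "affine_type \<Rightarrow> bool" where
  "valid_type (Aff_A n) \<longleftrightarrow> 1 \<le> n"
| "valid_type (Aff_B n) \<longleftrightarrow> 3 \<le> n"
| "valid_type (Aff_C n) \<longleftrightarrow> 2 \<le> n"
| "valid_type (Aff_D n) \<longleftrightarrow> 4 \<le> n"
| "valid_type (Tw_A_even n) \<longleftrightarrow> 1 \<le> n"
| "valid_type (Tw_A_odd n) \<longleftrightarrow> 3 \<le> n"
| "valid_type (Tw_D n) \<longleftrightarrow> 2 \<le> n"
| "valid_type _ \<longleftrightarrow> True"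

text \<open>An entry (i, j, x, y) is an edge of the Dynkin diagram, with Cartan matrix entries
  x in position (i, j) and y in position (j, i).  The labelling is Kac's, except that
  the types E6 and E7 (untwisted) carry the Bourbaki labelling.\<close>

definition chain :: "nat \<Rightarrow> nat \<Rightarrow> (nat \<times> nat \<times> int \<times> int) list" where
  "chain p q = map (\<lambda>k. (k, Suc k, -1, -1)) [p..<q]"

fun edges :: "affine_type \<Rightarrow> (nat \<times> nat \<times> int \<times> int) list" where
  "edges (Aff_A n) = (if n = 1 then [(0, 1, -2, -2)] else (0, n, -1, -1) # chain 0 n)"
| "edges (Aff_B n) = (0, 2, -1, -1) # chain 1 (n - 1) @ [(n - 1, n, -1, -2)]"
| "edges (Aff_C n) = (0, 1, -1, -2) # chain 1 (n - 1) @ [(n - 1, n, -2, -1)]"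
| "edges (Aff_D n) = (0, 2, -1, -1) # chain 1 (n - 1) @ [(n - 2, n, -1, -1)]"
| "edges Aff_E6 = [(0, 2, -1, -1), (2, 4, -1, -1), (1, 3, -1, -1), (3, 4, -1, -1),
     (4, 5, -1, -1), (5, 6, -1, -1)]"
| "edges Aff_E7 = [(0, 1, -1, -1), (2, 4, -1, -1), (1, 3, -1, -1), (3, 4, -1, -1),
     (4, 5, -1, -1), (5, 6, -1, -1), (6, 7, -1, -1)]"
| "edges Aff_E8 = chain 0 7 @ [(5, 8, -1, -1)]"
| "edges Aff_F4 = [(0, 1, -1, -1), (1, 2, -1, -1), (2, 3, -1, -2), (3, 4, -1, -1)]"
| "edges Aff_G2 = [(0, 1, -1, -1), (1, 2, -1, -3)]"
| "edges (Tw_A_even n) = (if n = 1 then [(0, 1, -4, -1)]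
     else (0, 1, -2, -1) # chain 1 (n - 1) @ [(n - 1, n, -2, -1)])"
| "edges (Tw_A_odd n) = (0, 2, -1, -1) # chain 1 (n - 1) @ [(n - 1, n, -2, -1)]"
| "edges (Tw_D n) = (0, 1, -2, -1) # chain 1 (n - 1) @ [(n - 1, n, -1, -2)]"
| "edges Tw_E6 = [(0, 1, -1, -1), (1, 2, -1, -1), (2, 3, -2, -1), (3, 4, -1, -1)]"
| "edges Tw_D4 = [(0, 1, -1, -1), (1, 2, -3, -1)]"

definition cartan :: "affine_type \<Rightarrow> nat \<Rightarrow> nat \<Rightarrow> int" where
  "cartan X i j = (if i = j then 2 else
     (\<Sum>(p, q, x, y) \<leftarrow> edges X.
        if p = i \<and> q = j then x else if p = j \<and> q = i then y else 0))"

text \<open>The index set is deliberately left unspecified for the type \<^const>\<open>Tw_A_even\<close>.\<close>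

fun index_J :: "affine_type \<Rightarrow> nat set" where
  "index_J (Aff_A n) = {0..n}"
| "index_J (Aff_B n) = {0, n}"
| "index_J (Aff_C n) = {0, 1}"
| "index_J (Aff_D n) = {0, 1, n - 1, n}"
| "index_J Aff_E6 = {0, 1, 6}"
| "index_J Aff_E7 = {0, 7}"
| "index_J Aff_E8 = {0}"
| "index_J Aff_F4 = {0}"
| "index_J Aff_G2 = {0}"
| "index_J (Tw_A_odd n) = {0, 1}"
| "index_J (Tw_D n) = {0, n}"
| "index_J Tw_E6 = {0}"
| "index_J Tw_D4 = {0}"

text \<open>The type variable is the (real form of the) dual of the Cartan subalgebra; the
  simple coroots are given through their pairing with it.\<close>

record 'v affine_datum =
  kind   :: affine_type
  mark   :: "nat \<Rightarrow> nat"
  comark :: "nat \<Rightarrow> nat"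
  coroot :: "nat \<Rightarrow> 'v \<Rightarrow> real"
  sroot  :: "nat \<Rightarrow> 'v"
  fundwt :: "nat \<Rightarrow> 'v"
  form   :: "'v \<Rightarrow> 'v \<Rightarrow> real"

definition rk :: "'v affine_datum \<Rightarrow> nat" where
  "rk D = rank (kind D)"

definition null_root :: "'v::real_vector affine_datum \<Rightarrow> 'v" where
  "null_root D = (\<Sum>i\<in>{0..rk D}. real (mark D i) *\<^sub>R sroot D i)"

text \<open>Pairing of a weight with the canonical central element.\<close>

definition level :: "'v affine_datum \<Rightarrow> 'v \<Rightarrow> real" where
  "level D \<mu> = (\<Sum>i\<in>{0..rk D}. real (comark D i) * coroot D i \<mu>)"

definition is_affine_datum :: "'v::real_vector affine_datum \<Rightarrow> bool" where
  "is_affine_datum D \<longleftrightarrow>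
     valid_type (kind D) \<and>
     (\<forall>i\<in>{0..rk D}. 0 < mark D i \<and> 0 < comark D i) \<and>
     Gcd (mark D ` {0..rk D}) = 1 \<and> Gcd (comark D ` {0..rk D}) = 1 \<and>
     (\<forall>i\<in>{0..rk D}. (\<Sum>j\<in>{0..rk D}. cartan (kind D) i j * int (mark D j)) = 0) \<and>
     (\<forall>j\<in>{0..rk D}. (\<Sum>i\<in>{0..rk D}. int (comark D i) * cartan (kind D) i j) = 0) \<and>
     (\<forall>i\<in>{0..rk D}. linear (coroot D i)) \<and>
     (\<forall>i\<in>{0..rk D}. \<forall>j\<in>{0..rk D}. coroot D i (sroot D j) = of_int (cartan (kind D) i j)) \<and>
     (\<forall>i\<in>{0..rk D}. \<forall>j\<in>{0..rk D}. coroot D j (fundwt D i) = (if i = j then 1 else 0)) \<and>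
     inj_on (fundwt D) {0..rk D} \<and> null_root D \<notin> fundwt D ` {0..rk D} \<and>
     independent (insert (null_root D) (fundwt D ` {0..rk D})) \<and>
     span (insert (null_root D) (fundwt D ` {0..rk D})) = UNIV \<and>
     (\<forall>\<mu>. linear (form D \<mu>)) \<and> (\<forall>\<mu> \<nu>. form D \<mu> \<nu> = form D \<nu> \<mu>) \<and>
     form D (fundwt D 0) (fundwt D 0) = 0 \<and>
     (\<forall>i\<in>{0..rk D}. \<forall>j\<in>{0..rk D}. form D (sroot D i) (sroot D j) =
        real (comark D i) / real (mark D i) * of_int (cartan (kind D) i j)) \<and>
     (\<forall>i\<in>{0..rk D}. form D (sroot D i) (fundwt D 0) =
        (if i = 0 then 1 / real (mark D 0) else 0))"

definition int_span :: "(nat \<Rightarrow> 'v::real_vector) \<Rightarrow> nat set \<Rightarrow> 'v set" where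
  "int_span f I = {\<Sum>i\<in>I. of_int (k i) *\<^sub>R f i | k :: nat \<Rightarrow> int. True}"

definition proj :: "'v::real_vector affine_datum \<Rightarrow> 'v \<Rightarrow> 'v" where
  "proj D \<mu> = \<mu> - level D \<mu> *\<^sub>R fundwt D 0 - form D \<mu> (fundwt D 0) *\<^sub>R null_root D"

definition root_lattice :: "'v::real_vector affine_datum \<Rightarrow> 'v set" where
  "root_lattice D = int_span (sroot D) {0..rk D}"

definition P0 :: "'v::real_vector affine_datum \<Rightarrow> 'v set" where
  "P0 D = int_span (\<lambda>i. proj D (fundwt D i)) {1..rk D}"

definition Q0 :: "'v::real_vector affine_datum \<Rightarrow> 'v set" where
  "Q0 D = int_span (\<lambda>i. proj D (sroot D i)) {1..rk D}"

definition P0_mod_Q0 :: "'v::real_vector affine_datum \<Rightarrow> 'v set set" where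
  "P0_mod_Q0 D = P0 D // {(x, y). x \<in> P0 D \<and> y \<in> P0 D \<and> x - y \<in> Q0 D}"

definition theta :: "'v::real_vector affine_datum \<Rightarrow> 'v" where
  "theta D = null_root D - real (mark D 0) *\<^sub>R sroot D 0"

text \<open>The dual of the finite Cartan subalgebra, as a subspace of the ambient space (the
  image of \<^const>\<open>proj\<close>).\<close>

definition h0_dual :: "'v::real_vector affine_datum \<Rightarrow> 'v set" where
  "h0_dual D = span (sroot D ` {1..rk D})"

definition alcove :: "'v::real_vector affine_datum \<Rightarrow> nat \<Rightarrow> 'v set" where
  "alcove D l = {\<mu> \<in> h0_dual D.
     (\<forall>i\<in>{1..rk D}. 0 \<le> coroot D i \<mu>) \<and> form D \<mu> (theta D) \<le> real l}"

text \<open>Dominant integral weights of level l modulo integer multiples of the null root, each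
  class being represented by its unique member with no null root component.\<close>

definition Pcl :: "'v::real_vector affine_datum \<Rightarrow> nat \<Rightarrow> 'v set" where
  "Pcl D l = {\<Sum>i\<in>{0..rk D}. real (m i) *\<^sub>R fundwt D i | m :: nat \<Rightarrow> nat.
     (\<Sum>i\<in>{0..rk D}. comark D i * m i) = l}"

definition sieving :: "'v::real_vector affine_datum \<Rightarrow> nat \<Rightarrow> ('v \<times> 'v) set" where
  "sieving D l = {(\<Lambda>, \<Lambda>'). \<Lambda> \<in> Pcl D l \<and> \<Lambda>' \<in> Pcl D l \<and>
     alcove D l \<inter> (\<lambda>q. proj D \<Lambda> + q) ` (proj D ` root_lattice D) =
     alcove D l \<inter> (\<lambda>q. proj D \<Lambda>' + q) ` (proj D ` root_lattice D)}"

lemma equiv_sieving: "equiv (Pcl D l) (sieving D l)"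
  by (auto simp: equiv_def refl_on_def sym_def trans_def sieving_def)

text \<open>For l = 0 and a nonzero index i the element below is not dominant.\<close>

definition DR :: "'v::real_vector affine_datum \<Rightarrow> nat \<Rightarrow> 'v set" where
  "DR D l = {(real l - 1) *\<^sub>R fundwt D 0 + fundwt D i | i. i \<in> index_J (kind D)}"

definition complete_representatives :: "'b set \<Rightarrow> ('b \<times> 'b) set \<Rightarrow> 'b set \<Rightarrow> bool" where
  "complete_representatives A r R \<longleftrightarrow>
     R \<subseteq> A \<and> (\<forall>x\<in>A. \<exists>y\<in>R. (x, y) \<in> r) \<and> (\<forall>x\<in>R. \<forall>y\<in>R. x \<noteq> y \<longrightarrow> (x, y) \<notin> r)"

end

theory Submission
  imports Defs
begin

text \<open>Outside type \<open>A\<^sub>2\<^sub>n\<^sup>(\<^sup>2\<^sup>)\<close> one has \<open>a\<^sub>0 = a\<^sub>0\<^sup>\<or> = 1\<close>, so the projection kills \<open>\<Lambda>\<^sub>0\<close> and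
  sends the root lattice onto \<open>Q\<^sub>0\<close>, and \<open>(\<mu>|\<theta>)\<close> is the sum of the \<open>a\<^sub>i\<^sup>\<or> \<langle>h\<^sub>i, \<mu>\<rangle>\<close>, \<open>i > 0\<close>, on the
  finite part.  Hence the projection of a weight of level \<open>l\<close> lies in the alcove, and two
  weights are equivalent iff their projections agree modulo \<open>Q\<^sub>0\<close>.  It remains that the
  projections of the \<open>\<Lambda>\<^sub>i\<close>, \<open>i \<in> J\<close>, represent \<open>P\<^sub>0 / Q\<^sub>0\<close>, which is checked type by type: the
  columns of the Cartan matrix, read as congruences, reduce every weight to one of them, and
  functionals integral on \<open>Q\<^sub>0\<close> separate them.\<close>

section \<open>Columns of the Cartan matrices\<close>

text \<open>The axioms give marks and comarks only as positive kernel vectors of the Cartan matrix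
  with gcd 1, so their value 1 at node 0 has to be extracted by solving the kernel equations in
  every type; the marks follow from the comarks of the transposed type.

  The rank is symbolic in the infinite families. What makes them tractable is that along a chain of
  the diagram the columns say that second differences vanish modulo the subgroup at hand: the
  weights form an arithmetic progression, and the ends of the diagram fix the order of its common
  difference.

  The alcove lies in the span of the finite simple roots, and that projections land there is not an
  axiom. It is obtained without inverting a Cartan matrix, by running the residue argument modulo
  this subspace and applying the pigeonhole principle.\<close>

text \<open>One sum serves three purposes: with the fundamental weights for \<open>f\<close> it is the
  simple root \<open>\<alpha>\<^sub>j\<close> modulo the null root, with the values of a linear functional on the
  fundamental weights it is its value on \<open>\<alpha>\<^sub>j\<close>, and its common zeros over all \<open>j\<close> are the
  multiples of the comarks.\<close>

definition col_sum :: "affine_type \<Rightarrow> (nat \<Rightarrow> 'v::real_vector) \<Rightarrow> nat \<Rightarrow> 'v" where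
  "col_sum X f j = (\<Sum>i\<in>{0..rank X}. of_int (cartan X i j) *\<^sub>R f i)"

text \<open>An edge meets column \<open>j\<close> in at most one row: row \<open>p\<close> if
  \<open>q = j\<close>, row \<open>q\<close> if \<open>p = j\<close>. Exchanging the two sums leaves
  one term per edge. The condition \<open>p \<noteq> q\<close> keeps edges off the diagonal, which
  \<open>cartan\<close> fills separately.\<close>

lemma sum_edge_list:
  fixes f :: "nat \<Rightarrow> 'v::real_vector"
  assumes "finite I" and "\<forall>(p, q, x, y)\<in>set es. p \<noteq> q \<and> p \<in> I \<and> q \<in> I"
  shows "(\<Sum>i\<in>I. of_int (if i = j then 0 else (\<Sum>(p, q, x, y)\<leftarrow>es.
            if p = i \<and> q = j then x else if p = j \<and> q = i then y else 0)) *\<^sub>R f i)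
       = (\<Sum>(p, q, x, y)\<leftarrow>es. (if q = j then of_int x *\<^sub>R f p else 0)
            + (if p = j then of_int y *\<^sub>R f q else 0))"
  using assms(2)
proof (induction es)
  case (Cons e es)
  obtain p q x y where e: "e = (p, q, x, y)" by (cases e)
  have pq: "p \<noteq> q" "p \<in> I" "q \<in> I" using Cons.prems e by auto
  let ?S = "\<lambda>i. \<Sum>(p, q, x, y)\<leftarrow>es.
            if p = i \<and> q = j then x else if p = j \<and> q = i then y else (0::int)"
  have "(\<Sum>i\<in>I. of_int (if i = j then 0 else (\<Sum>(p, q, x, y)\<leftarrow>e # es.
            if p = i \<and> q = j then x else if p = j \<and> q = i then y else 0)) *\<^sub>R f i)
     = (\<Sum>i\<in>I. (if p = i then if q = j then of_int x *\<^sub>R f i else 0 else 0)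
          + (if q = i then if p = j then of_int y *\<^sub>R f i else 0 else 0)
          + of_int (if i = j then 0 else ?S i) *\<^sub>R f i)"
    using pq(1) by (intro sum.cong) (auto simp: e scaleR_add_left)
  also have "\<dots> = (if q = j then of_int x *\<^sub>R f p else 0)
            + (if p = j then of_int y *\<^sub>R f q else 0)
          + (\<Sum>i\<in>I. of_int (if i = j then 0 else ?S i) *\<^sub>R f i)"
    using assms(1) pq by (simp add: sum.distrib)
  finally show ?case using Cons by (simp add: e)
qed (simp cong: if_cong)

lemma edges_in_range:
  assumes "valid_type X" "(p, q, x, y) \<in> set (edges X)"
  shows "p \<noteq> q \<and> p \<le> rank X \<and> q \<le> rank X"
  using assms by (cases X) (auto simp: chain_def split: if_splits)

lemma col_sum_edges:
  assumes "valid_type X" "j \<le> rank X"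
  shows "col_sum X f j = 2 *\<^sub>R f j + (\<Sum>(p, q, x, y)\<leftarrow>edges X.
     (if q = j then of_int x *\<^sub>R f p else 0) + (if p = j then of_int y *\<^sub>R f q else 0))"
proof -
  have "col_sum X f j = (\<Sum>i\<in>{0..rank X}. (if j = i then 2 *\<^sub>R f i else 0)
     + of_int (if i = j then 0 else (\<Sum>(p, q, x, y)\<leftarrow>edges X.
            if p = i \<and> q = j then x else if p = j \<and> q = i then y else 0)) *\<^sub>R f i)"
    unfolding col_sum_def cartan_def by (intro sum.cong) auto
  also have "\<dots> = 2 *\<^sub>R f j + (\<Sum>(p, q, x, y)\<leftarrow>edges X.
     (if q = j then of_int x *\<^sub>R f p else 0) + (if p = j then of_int y *\<^sub>R f q else 0))"
    unfolding sum.distrib using assms edges_in_range[OF assms(1)]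
    by (subst sum_edge_list) auto
  finally show ?thesis .
qed

text \<open>Node \<open>j\<close> of a chain sees its predecessor and its successor, save at the two
  ends. This closed form is what makes columns of symbolic rank computable.\<close>

lemma sum_chain:
  fixes f :: "nat \<Rightarrow> 'v::real_vector"
  shows "(\<Sum>(p, q, x, y)\<leftarrow>chain a b. (if q = j then of_int x *\<^sub>R f p else 0)
            + (if p = j then of_int y *\<^sub>R f q else 0))
     = - (if a < j \<and> j \<le> b then f (j - 1) else 0) - (if a \<le> j \<and> j < b then f (Suc j) else 0)"
proof (induction b)
  case (Suc b)
  show ?case
  proof (cases "a \<le> b")
    case True
    then have "chain a (Suc b) = chain a b @ [(b, Suc b, -1, -1)]" by (simp add: chain_def)
    then show ?thesis using Suc True by (auto simp: less_Suc_eq le_Suc_eq)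
  qed (auto simp: chain_def)
qed (auto simp: chain_def)

lemma col_sum_A:
  assumes "1 \<le> n" "j \<le> n"
  shows "col_sum (Aff_A n) f j = 2 *\<^sub>R f j - (if j = 0 then f n else f (j - 1))
     - (if j = n then f 0 else f (Suc j))"
  \<comment> \<open>For \<open>n = 1\<close> the two neighbours of a node coincide, so the cyclic
    formula also yields the entries -2 of that matrix.\<close>
  using assms by (subst col_sum_edges) (auto simp: sum_chain scaleR_2 intro!: arg_cong[of _ _ f])

lemma col_sum_B:
  assumes "3 \<le> n" "j \<le> n"
  shows "col_sum (Aff_B n) f j = 2 *\<^sub>R f j
    - (if j = 0 then f 2 else if j = 2 then f 0 + f 1 else if j = 1 then 0 else f (j - 1))
     - (if j = 0 \<or> j = n then 0 else if j = n - 1 then 2 *\<^sub>R f n else f (Suc j))"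
  using assms by (subst col_sum_edges) (auto simp: sum_chain scaleR_2 intro!: arg_cong[of _ _ f])

lemma col_sum_A_odd:
  assumes "3 \<le> n" "j \<le> n"
  shows "col_sum (Tw_A_odd n) f j = 2 *\<^sub>R f j
    - (if j = 0 then f 2 else if j = 2 then f 0 + f 1 else if j = 1 then 0
      else if j = n then 2 *\<^sub>R f (n - 1) else f (j - 1))
     - (if j = 0 \<or> j = n then 0 else f (Suc j))"
  using assms by (subst col_sum_edges) (auto simp: sum_chain scaleR_2 intro!: arg_cong[of _ _ f])

lemma col_sum_C:
  assumes "2 \<le> n" "j \<le> n"
  shows "col_sum (Aff_C n) f j = 2 *\<^sub>R f j
    - (if j = 0 then 2 *\<^sub>R f 1 else if j = n then 2 *\<^sub>R f (n - 1) else f (j - 1))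
     - (if j = 0 \<or> j = n then 0 else f (Suc j))"
  using assms by (subst col_sum_edges) (auto simp: sum_chain scaleR_2 intro!: arg_cong[of _ _ f])

lemma col_sum_D_tw:
  assumes "2 \<le> n" "j \<le> n"
  shows "col_sum (Tw_D n) f j = 2 *\<^sub>R f j
    - (if j = 0 then f 1 else if j = 1 then 2 *\<^sub>R f 0 else f (j - 1))
     - (if j = 0 \<or> j = n then 0 else if j = n - 1 then 2 *\<^sub>R f n else f (Suc j))"
  using assms by (subst col_sum_edges) (auto simp: sum_chain scaleR_2 intro!: arg_cong[of _ _ f])

lemma col_sum_D:
  assumes "4 \<le> n" "j \<le> n"
  shows "col_sum (Aff_D n) f j = 2 *\<^sub>R f j
    - (if j = 0 then f 2 else if j = 2 then f 0 + f 1 else if j = 1 then 0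
      else if j = n then f (n - 2) else f (j - 1))
     - (if j = 0 \<or> j = n \<or> j = n - 1 then 0 else if j = n - 2 then f (n - 1) + f n else f (Suc j))"
proof -
  \<comment> \<open>With \<open>n\<close> a double successor no truncated subtraction gets in the
    way. The case split below isolates the two forks, which meet at node 2 when
    \<open>n = 4\<close>.\<close>
  obtain m where n: "n = Suc (Suc m)" "2 \<le> m"
    using assms(1)
      by (metis One_nat_def Suc_le_D Suc_le_mono numeral_2_eq_2 numeral_Bit0 add_2_eq_Suc)
  have e: "edges (Aff_D n) = (0, 2, -1, -1) # chain 1 (Suc m) @ [(m, Suc (Suc m), -1, -1)]"
    using n by simp
  have col: "col_sum (Aff_D n) f j = 2 *\<^sub>R f j + (((if 2 = j then - f 0 else 0)
    + (if 0 = j then - f 2 else 0))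
     + (- (if 1 < j \<and> j \<le> Suc m then f (j - 1) else 0)
       - (if 1 \<le> j \<and> j < Suc m then f (Suc j) else 0)
     + ((if Suc (Suc m) = j then - f m else 0) + (if m = j then - f (Suc (Suc m)) else 0))))"
  proof (subst col_sum_edges)
    show "valid_type (Aff_D n)" "j \<le> rank (Aff_D n)" using assms by auto
  qed (simp only: e list.map map_append sum_list.Cons sum_list.Nil sum_list_append sum_chain prod.case
    of_int_minus of_int_1 scaleR_minus_left scaleR_one add_0_right)
  consider "j = 0" | "j = 1" | "j = 2" | "2 < j" "j < m" | "2 < j" "j = m" | "j = Suc m"
    | "j = Suc (Suc m)"
    using assms(2) n by linarith
  then show ?thesis
    unfolding col by (cases; use n(2) in \<open>simp add: n(1) numeral_2_eq_2\<close>)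
qed

section \<open>Transposed Cartan matrices\<close>

fun dual_type :: "affine_type \<Rightarrow> affine_type" where
  "dual_type (Aff_B n) = Tw_A_odd n"
| "dual_type (Tw_A_odd n) = Aff_B n"
| "dual_type (Aff_C n) = Tw_D n"
| "dual_type (Tw_D n) = Aff_C n"
| "dual_type Aff_F4 = Tw_E6"
| "dual_type Tw_E6 = Aff_F4"
| "dual_type Aff_G2 = Tw_D4"
| "dual_type Tw_D4 = Aff_G2"
| "dual_type X = X"

lemma edges_dual:
  assumes "valid_type X" "\<nexists>n. X = Tw_A_even n"
  shows "edges (dual_type X) = map (\<lambda>(p, q, x, y). (p, q, y, x)) (edges X)"
  using assms by (cases X) (auto simp: chain_def)

text \<open>The marks are the comarks of the transposed matrix, so one kernel computation serves
  both. \<open>Tw_A_even\<close> is excluded: its transpose is the same type only after reversing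
  the labels, whereas the default clause of \<open>dual_type\<close> keeps them.\<close>

lemma cartan_dual:
  assumes "valid_type X" "\<nexists>n. X = Tw_A_even n"
  shows "cartan (dual_type X) i j = cartan X j i"
proof (cases "i = j")
  case False
  then show ?thesis
    unfolding cartan_def edges_dual[OF assms]
    by (auto simp: comp_def intro!: arg_cong[of _ _ sum_list])
qed (simp add: cartan_def)

lemma
  assumes "valid_type X" "\<nexists>n. X = Tw_A_even n"
  shows valid_type_dual: "valid_type (dual_type X)"
    and rank_dual: "rank (dual_type X) = rank X"
    and dual_not_A_even: "\<nexists>n. dual_type X = Tw_A_even n"
  using assms by (cases X; auto)+

section \<open>Subgroups and congruences\<close>

text \<open>A bare additive subgroup covers all uses: the trivial group for kernels,
  \<open>Q0 D\<close> for residues, and the subspace \<open>h0_dual D\<close>.\<close>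

definition add_subgroup :: "'v::real_vector set \<Rightarrow> bool" where
  "add_subgroup Q \<longleftrightarrow> 0 \<in> Q \<and> (\<forall>x\<in>Q. \<forall>y\<in>Q. x - y \<in> Q)"

lemma add_subgroup_zero: "add_subgroup Q \<Longrightarrow> 0 \<in> Q"
  and add_subgroup_diff: "add_subgroup Q \<Longrightarrow> x \<in> Q \<Longrightarrow> y \<in> Q \<Longrightarrow> x - y \<in> Q"
  by (auto simp: add_subgroup_def)

lemma add_subgroup_minus: "add_subgroup Q \<Longrightarrow> x \<in> Q \<Longrightarrow> - x \<in> Q"
  using add_subgroup_diff[of Q 0 x] add_subgroup_zero[of Q] by simp

lemma add_subgroup_add: "add_subgroup Q \<Longrightarrow> x \<in> Q \<Longrightarrow> y \<in> Q \<Longrightarrow> x + y \<in> Q"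
  using add_subgroup_diff[of Q x "- y"] add_subgroup_minus[of Q y] by simp

lemma add_subgroup_sum:
  "add_subgroup Q \<Longrightarrow> (\<And>i. i \<in> I \<Longrightarrow> f i \<in> Q) \<Longrightarrow> sum f I \<in> Q"
  by (induction I rule: infinite_finite_induct) (auto simp: add_subgroup_zero add_subgroup_add)

lemma add_subgroup_scale_nat: "add_subgroup Q \<Longrightarrow> x \<in> Q \<Longrightarrow> real n *\<^sub>R x \<in> Q"
  by (induction n) (auto simp: add_subgroup_zero add_subgroup_add scaleR_add_left)

lemma add_subgroup_double: "add_subgroup Q \<Longrightarrow> x \<in> Q \<Longrightarrow> 2 *\<^sub>R x \<in> Q"
  using add_subgroup_scale_nat[of Q x 2] by simp

lemma add_subgroup_scale_int: "add_subgroup Q \<Longrightarrow> x \<in> Q \<Longrightarrow> of_int k *\<^sub>R x \<in> Q"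
  using add_subgroup_scale_nat[of Q x] add_subgroup_minus[of Q]
  by (cases k rule: int_cases2) fastforce+

lemma add_subgroup_trans:
  "add_subgroup Q \<Longrightarrow> x - y \<in> Q \<Longrightarrow> y - z \<in> Q \<Longrightarrow> x - z \<in> Q"
  using add_subgroup_add[of Q "x - y" "y - z"] by simp

lemma add_subgroup_sym: "add_subgroup Q \<Longrightarrow> x - y \<in> Q \<Longrightarrow> y - x \<in> Q"
  using add_subgroup_minus[of Q "x - y"] by simp

lemma add_subgroup_0: "add_subgroup {0}"
  by (simp add: add_subgroup_def)

text \<open>Vanishing second differences modulo \<open>Q\<close> force an arithmetic progression
  modulo \<open>Q\<close>. Only interior nodes are constrained, so the ends may fork or carry a
  multiple edge.\<close>

lemma chain_progression:
  fixes f :: "nat \<Rightarrow> 'v::real_vector"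
  assumes Q: "add_subgroup Q"
    and step: "\<And>j. a < j \<Longrightarrow> j < b \<Longrightarrow> 2 *\<^sub>R f j - f (j - 1) - f (Suc j) \<in> Q"
  shows "a + i \<le> b \<Longrightarrow> f (a + i) - (f a + real i *\<^sub>R (f (Suc a) - f a)) \<in> Q"
proof (induction i rule: less_induct)
  case (less i)
  show ?case
  proof (cases "i < 2")
    case True
    then have "i = 0 \<or> i = 1" by auto
    then show ?thesis using add_subgroup_zero[OF Q] by auto
  next
    case False
    then obtain k where k: "i = Suc (Suc k)" using add_2_eq_Suc le_Suc_ex by (metis not_less)
    let ?d = "f (Suc a) - f a"
    let ?e = "\<lambda>i. f (a + i) - (f a + real i *\<^sub>R ?d)"
    \<comment> \<open>A progression has zero second differences, so the error \<open>?e\<close>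
      obeys the recurrence of \<open>f\<close>: its last value is a combination of the two before it
      and one instance of \<open>step\<close>.\<close>
    have eq: "f (a + i) - (f a + real i *\<^sub>R ?d)
      = 2 *\<^sub>R ?e (Suc k) - ?e k - (2 *\<^sub>R f (a + Suc k) - f (a + k) - f (a + i))"
      by (simp add: k algebra_simps scaleR_2, simp only: mult_2_right scaleR_add_left add_ac)
    have "2 *\<^sub>R f (a + Suc k) - f (a + k) - f (a + i) \<in> Q"
      using step[of "a + Suc k"] less.prems k by simp
    moreover have "?e (Suc k) \<in> Q" "?e k \<in> Q"
      using less.IH[of "Suc k"] less.IH[of k] less.prems k by auto
    moreover from this have "2 *\<^sub>R ?e (Suc k) \<in> Q"
      using add_subgroup_scale_int[OF Q, of _ 2] by simp
    ultimately show ?thesis unfolding eq using add_subgroup_diff[OF Q] by blast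
  qed
qed

text \<open>Modulo \<open>Q\<close> every \<open>f p\<close> is a multiple of \<open>g\<close>, and
  \<open>N\<close> kills \<open>g\<close>; hence \<open>J\<close> only has to meet each residue.
  That the order is exactly \<open>N\<close> is not claimed here.\<close>

lemma cyclic_residue:
  fixes f :: "nat \<Rightarrow> 'v::real_vector"
  assumes Q: "add_subgroup Q" and gen: "\<And>p. p \<le> n \<Longrightarrow> f p - of_int (c p) *\<^sub>R g \<in> Q"
    and N: "real N *\<^sub>R g \<in> Q" "0 < N"
    and J: "\<And>r. r < N \<Longrightarrow> \<exists>i\<in>J. f i - real r *\<^sub>R g \<in> Q"
  shows "\<exists>i\<in>J. (\<Sum>p\<in>{0..n}. of_int (k p) *\<^sub>R f p) - f i \<in> Q"
proof -
  define K where "K = (\<Sum>p\<in>{0..n}. k p * c p)"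
  define r where "r = nat (K mod int N)"
  have r: "r < N" "K = int N * (K div int N) + int r"
    using N(2) by (auto simp: r_def nat_less_iff)
  then obtain i where i: "i \<in> J" "f i - real r *\<^sub>R g \<in> Q" using J by blast
  have "(\<Sum>p\<in>{0..n}. of_int (k p) *\<^sub>R (f p - of_int (c p) *\<^sub>R g)) \<in> Q"
    using gen by (intro add_subgroup_sum add_subgroup_scale_int Q) auto
  moreover have "(\<Sum>p\<in>{0..n}. of_int (k p) *\<^sub>R (f p - of_int (c p) *\<^sub>R g))
      = (\<Sum>p\<in>{0..n}. of_int (k p) *\<^sub>R f p) - of_int K *\<^sub>R g"
    by (simp add: K_def sum_subtractf scaleR_diff_right scaleR_left.sum)
  ultimately have "(\<Sum>p\<in>{0..n}. of_int (k p) *\<^sub>R f p) - of_int K *\<^sub>R g \<in> Q" by simp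
  moreover have "of_int K *\<^sub>R g - real r *\<^sub>R g \<in> Q"
  proof -
    have "of_int K *\<^sub>R g = of_int (K div int N) *\<^sub>R real N *\<^sub>R g + real r *\<^sub>R g"
      by (subst r(2)) (simp add: scaleR_add_left mult.commute)
    then show ?thesis using add_subgroup_scale_int[OF Q N(1)] by simp
  qed
  moreover have "real r *\<^sub>R g - f i \<in> Q" using add_subgroup_sym[OF Q i(2)] .
  ultimately show ?thesis using i(1) add_subgroup_trans[OF Q] by blast
qed

text \<open>As \<open>f 0\<close> vanishes, the row of node 0 drops out and the columns are those of
  the finite Cartan matrix. A solution \<open>k\<close> of that system writes the weight with
  coordinates \<open>c\<close> as an integral combination of roots.\<close>

lemma column_combination:
  fixes f :: "nat \<Rightarrow> 'v::real_vector"
  assumes Q: "add_subgroup Q" and f0: "f 0 = 0"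
    and col: "\<And>j. j \<in> {1..rank X} \<Longrightarrow> col_sum X f j \<in> Q"
    and K: "\<forall>p\<in>{1..rank X}. (\<Sum>j\<in>{1..rank X}. cartan X p j * k j) = c p"
  shows "(\<Sum>p\<in>{1..rank X}. of_int (c p) *\<^sub>R f p) \<in> Q"
proof -
  have nz: "{0..rank X} = insert 0 {1..rank X}" by auto
  have "(\<Sum>j\<in>{1..rank X}. of_int (k j) *\<^sub>R col_sum X f j) \<in> Q"
    by (intro add_subgroup_sum add_subgroup_scale_int Q col)
  also have "(\<Sum>j\<in>{1..rank X}. of_int (k j) *\<^sub>R col_sum X f j)
     = (\<Sum>j\<in>{1..rank X}. \<Sum>p\<in>{1..rank X}. of_int (cartan X p j * k j) *\<^sub>R f p)"
    by (simp add: col_sum_def nz f0 scaleR_sum_right mult.commute)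
  also have "\<dots> = (\<Sum>p\<in>{1..rank X}. of_int (\<Sum>j\<in>{1..rank X}. cartan X p j * k j) *\<^sub>R f p)"
    by (subst sum.swap) (simp add: scaleR_left.sum)
  also have "\<dots> = (\<Sum>p\<in>{1..rank X}. of_int (c p) *\<^sub>R f p)"
    using K by (intro sum.cong) auto
  finally show ?thesis .
qed

text \<open>Row \<open>q\<close> of \<open>K\<close> holds the coefficients of \<open>\<omega>\<^sub>q - c\<^sub>q \<omega>\<^sub>g\<close> in the simple roots of the finite
  part, where \<open>c\<^sub>q = cs ! (q - 1)\<close>.  Taking \<open>c\<^sub>g = 1 - N\<close> rather than \<open>1\<close> makes row \<open>g\<close> witness that
  \<open>N \<omega>\<^sub>g\<close> is in the root lattice.\<close>

definition residue_certificate :: "affine_type \<Rightarrow> nat \<Rightarrow> int list \<Rightarrow> int list list \<Rightarrow> bool" where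
  "residue_certificate X g cs K \<longleftrightarrow> list_all (\<lambda>q. list_all (\<lambda>p.
     (\<Sum>j\<leftarrow>[1..<Suc (rank X)]. cartan X p j * K ! (q - 1) ! (j - 1))
       = (if p = q then 1 else 0) - (if p = g then cs ! (q - 1) else 0))
     [1..<Suc (rank X)]) [1..<Suc (rank X)]"

lemma certified_residue:
  fixes f :: "nat \<Rightarrow> 'v::real_vector"
  assumes Q: "add_subgroup Q" and f0: "f 0 = 0"
    and col: "\<And>j. j \<in> {1..rank X} \<Longrightarrow> col_sum X f j \<in> Q"
    and K: "residue_certificate X g cs K" and g: "g \<in> {1..rank X}" and q: "q \<in> {1..rank X}"
  shows "f q - of_int (cs ! (q - 1)) *\<^sub>R f g \<in> Q"
proof -
  let ?c = "\<lambda>p. (if p = q then 1 else 0) - (if p = g then cs ! (q - 1) else 0)"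
  have "\<forall>p\<in>{1..rank X}. (\<Sum>j\<in>{1..rank X}. cartan X p j * K ! (q - 1) ! (j - 1)) = ?c p"
    using K q
    by (auto simp: residue_certificate_def list_all_iff sum_list_distinct_conv_sum_set
          atLeastLessThanSuc_atLeastAtMost simp del: upt_Suc)
  then have "(\<Sum>p\<in>{1..rank X}. of_int (?c p) *\<^sub>R f p) \<in> Q"
    by (intro column_combination[OF Q f0 col]) auto
  moreover have "(\<Sum>p\<in>{1..rank X}. of_int (?c p) *\<^sub>R f p)
     = (\<Sum>p\<in>{1..rank X}. (if p = q then f p else 0)
         - (if p = g then of_int (cs ! (q - 1)) *\<^sub>R f p else 0))"
    by (intro sum.cong) (auto simp: scaleR_diff_left)
  ultimately show ?thesis using g q by (simp add: sum_subtractf)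
qed

text \<open>The first row expresses three times the first fundamental weight in simple roots; the
  other entries of the short list are residues modulo 3 relative to that weight. A finite identity
  of integers, settled by evaluation.\<close>

lemma certificate_Aff_E6:
  "residue_certificate Aff_E6 1 [-2, 0, 2, 0, 1, 2]
    [[4, 3, 5, 6, 4, 2],
     [1, 2, 2, 3, 2, 1],
     [-1, 0, 0, 0, 0, 0],
     [2, 3, 4, 6, 4, 2],
     [0, 1, 1, 2, 2, 1],
     [-2, -1, -2, -2, -1, 0]]"
  by code_simp

text \<open>Node 7 carries the minuscule weight, of order 2, so the residues are parities; the final
  -1 is \<open>1 - N\<close> with \<open>N = 2\<close>.\<close>

lemma certificate_Aff_E7:
  "residue_certificate Aff_E7 7 [0, 1, 0, 0, 1, 0, -1]
    [[2, 2, 3, 4, 3, 2, 1],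
     [1, 2, 2, 3, 2, 1, 0],
     [3, 4, 6, 8, 6, 4, 2],
     [4, 6, 8, 12, 9, 6, 3],
     [2, 3, 4, 6, 5, 3, 1],
     [2, 3, 4, 6, 5, 4, 2],
     [2, 3, 4, 6, 5, 4, 3]]"
  by code_simp

text \<open>With \<open>N = 1\<close> all residues are 0 and the rows are the columns of the inverse
  finite Cartan matrix, integral because the determinant is 1. The same holds for the four
  certificates that follow.\<close>

lemma certificate_Aff_E8:
  "residue_certificate Aff_E8 1 [0, 0, 0, 0, 0, 0, 0, 0]
    [[2, 3, 4, 5, 6, 4, 2, 3],
     [3, 6, 8, 10, 12, 8, 4, 6],
     [4, 8, 12, 15, 18, 12, 6, 9],
     [5, 10, 15, 20, 24, 16, 8, 12],
     [6, 12, 18, 24, 30, 20, 10, 15],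
     [4, 8, 12, 16, 20, 14, 7, 10],
     [2, 4, 6, 8, 10, 7, 4, 5],
     [3, 6, 9, 12, 15, 10, 5, 8]]"
  by code_simp

lemma certificate_Aff_F4:
  "residue_certificate Aff_F4 1 [0, 0, 0, 0]
    [[2, 3, 4, 2], [3, 6, 8, 4], [2, 4, 6, 3], [1, 2, 3, 2]]"
  by code_simp

lemma certificate_Aff_G2:
  "residue_certificate Aff_G2 1 [0, 0]
    [[2, 3], [1, 2]]"
  by code_simp

lemma certificate_Tw_E6:
  "residue_certificate Tw_E6 1 [0, 0, 0, 0]
    [[2, 3, 2, 1], [3, 6, 4, 2], [4, 8, 6, 3], [2, 4, 3, 2]]"
  by code_simp

lemma certificate_Tw_D4:
  "residue_certificate Tw_D4 1 [0, 0]
    [[2, 1], [3, 2]]"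
  by code_simp

section \<open>Marks and comarks\<close>

text \<open>A progression with first difference 0. The guard \<open>a < b\<close> admits a chain
  shrunk to one node, as happens for \<open>Aff_B 3\<close> and \<open>Aff_D 4\<close>.\<close>

lemma chain_constant:
  fixes f :: "nat \<Rightarrow> real"
  assumes "\<And>j. a < j \<Longrightarrow> j < b \<Longrightarrow> 2 * f j - f (j - 1) - f (Suc j) = 0"
    and "a < b \<Longrightarrow> f (Suc a) = f a" and "a \<le> i" "i \<le> b"
  shows "f i = f a"
proof (cases "a < b")
  case True
  have "f (a + (i - a)) - (f a + real (i - a) *\<^sub>R (f (Suc a) - f a)) \<in> {0}"
    using assms by (intro chain_progression[OF add_subgroup_0, where b = b]) auto
  then show ?thesis using assms True by auto
next
  case False
  then have "i = a" using assms(3,4) by linarith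
  then show ?thesis by simp
qed

text \<open>At fixed rank the columns form a small linear system with \<open>f 0\<close> as its free
  parameter; the lists in the proof are the comarks.\<close>

lemma kernel_exceptional:
  fixes f :: "nat \<Rightarrow> real"
  assumes "\<And>j. j \<le> rank X \<Longrightarrow> col_sum X f j = 0"
    and "X \<in> {Aff_E6, Aff_E7, Aff_E8, Aff_F4, Aff_G2, Tw_E6, Tw_D4}"
  shows "\<exists>k::nat\<Rightarrow>nat. \<forall>i\<le>rank X. f i = real (k i) * f 0 \<and> (i \<in> index_J X \<longrightarrow> k i = 1)"
proof -
  have eqs: "col_sum X f 0 = 0" "1 \<le> rank X \<Longrightarrow> col_sum X f 1 = 0" "2 \<le> rank X \<Longrightarrow> col_sum X f 2 = 0"
    "3 \<le> rank X \<Longrightarrow> col_sum X f 3 = 0" "4 \<le> rank X \<Longrightarrow> col_sum X f 4 = 0"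
      "5 \<le> rank X \<Longrightarrow> col_sum X f 5 = 0"
    "6 \<le> rank X \<Longrightarrow> col_sum X f 6 = 0" "7 \<le> rank X \<Longrightarrow> col_sum X f 7 = 0"
      "8 \<le> rank X \<Longrightarrow> col_sum X f 8 = 0"
    using assms(1) by auto
  have fin: ?thesis
    if "\<forall>i\<in>set [0..<Suc (rank X)]. f i = real (ks ! i) * f 0 \<and> (i \<in> index_J X \<longrightarrow> ks ! i = 1)" for ks
  proof (intro exI[of _ "\<lambda>i. ks ! i"] allI impI)
    fix i assume "i \<le> rank X"
    then have "i \<in> set [0..<Suc (rank X)]" by (simp del: upt_Suc)
    then show "f i = real (ks ! i) * f 0 \<and> (i \<in> index_J X \<longrightarrow> ks ! i = 1)" using that by blast
  qed
  have chain_0_7: "chain 0 7 = [(0, 1, -1, -1), (1, 2, -1, -1), (2, 3, -1, -1), (3, 4, -1, -1),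
     (4, 5, -1, -1), (5, 6, -1, -1), (6, 7, -1, -1)]"
    by code_simp
  note [simp] = col_sum_edges chain_0_7
  have "X = Aff_E6 \<or> X = Aff_E7 \<or> X = Aff_E8 \<or> X = Aff_F4 \<or> X = Aff_G2 \<or> X = Tw_E6 \<or> X = Tw_D4"
    using assms(2) by blast
  then show ?thesis
  proof (elim disjE)
    assume X: "X = Aff_E6"
    then have "f 1 = f 0 \<and> f 2 = 2 * f 0 \<and> f 3 = 2 * f 0 \<and> f 4 = 3 * f 0 \<and> f 5 = 2 * f 0
      \<and> f 6 = f 0"
      using eqs[unfolded X, simplified] unfolding One_nat_def by (intro conjI; linarith)
    then show ?thesis by (intro fin[of "[1,1,2,2,3,2,1]"]) (simp add: X upt_rec numeral_eq_Suc)
  next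
    assume X: "X = Aff_E7"
    then have "f 1 = 2 * f 0 \<and> f 2 = 2 * f 0 \<and> f 3 = 3 * f 0 \<and> f 4 = 4 * f 0 \<and> f 5 = 3 * f 0
      \<and> f 6 = 2 * f 0 \<and> f 7 = f 0"
      using eqs[unfolded X, simplified] unfolding One_nat_def by (intro conjI; linarith)
    then show ?thesis by (intro fin[of "[1,2,2,3,4,3,2,1]"]) (simp add: X upt_rec numeral_eq_Suc)
  next
    assume X: "X = Aff_E8"
    then have "f 1 = 2 * f 0 \<and> f 2 = 3 * f 0 \<and> f 3 = 4 * f 0 \<and> f 4 = 5 * f 0 \<and> f 5 = 6 * f 0
      \<and> f 6 = 4 * f 0 \<and> f 7 = 2 * f 0 \<and> f 8 = 3 * f 0"
      using eqs[unfolded X, simplified] unfolding One_nat_def by (intro conjI; linarith)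
    then show ?thesis by (intro fin[of "[1,2,3,4,5,6,4,2,3]"]) (simp add: X upt_rec numeral_eq_Suc)
  next
    assume X: "X = Aff_F4"
    then have "f 1 = 2 * f 0 \<and> f 2 = 3 * f 0 \<and> f 3 = 2 * f 0 \<and> f 4 = f 0"
      using eqs[unfolded X, simplified] unfolding One_nat_def by (intro conjI; linarith)
    then show ?thesis by (intro fin[of "[1,2,3,2,1]"]) (simp add: X upt_rec numeral_eq_Suc)
  next
    assume X: "X = Aff_G2"
    then have "f 1 = 2 * f 0 \<and> f 2 = f 0"
      using eqs[unfolded X, simplified] unfolding One_nat_def by (intro conjI; linarith)
    then show ?thesis by (intro fin[of "[1,2,1]"]) (simp add: X upt_rec numeral_eq_Suc)
  next
    assume X: "X = Tw_E6"
    then have "f 1 = 2 * f 0 \<and> f 2 = 3 * f 0 \<and> f 3 = 4 * f 0 \<and> f 4 = 2 * f 0"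
      using eqs[unfolded X, simplified] unfolding One_nat_def by (intro conjI; linarith)
    then show ?thesis by (intro fin[of "[1,2,3,4,2]"]) (simp add: X upt_rec numeral_eq_Suc)
  next
    assume X: "X = Tw_D4"
    then have "f 1 = 2 * f 0 \<and> f 2 = 3 * f 0"
      using eqs[unfolded X, simplified] unfolding One_nat_def by (intro conjI; linarith)
    then show ?thesis by (intro fin[of "[1,2,3]"]) (simp add: X upt_rec numeral_eq_Suc)
  qed
qed

text \<open>Natural multipliers make \<open>f 0\<close> a divisor of every entry of an integral
  kernel vector, which is what the gcd condition needs. The value 1 on \<open>index_J X\<close>
  later gives \<open>dr l i\<close> the level \<open>l\<close>.\<close>

lemma kernel_multiples:
  fixes f :: "nat \<Rightarrow> real"
  assumes X: "valid_type X" "\<nexists>n. X = Tw_A_even n"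
    and col: "\<And>j. j \<le> rank X \<Longrightarrow> col_sum X f j = 0"
  shows "\<exists>k::nat\<Rightarrow>nat. \<forall>i\<le>rank X. f i = real (k i) * f 0 \<and> (i \<in> index_J X \<longrightarrow> k i = 1)"
proof -
  have fin: ?thesis if "\<And>i. i \<le> rank X \<Longrightarrow> f i = real (k i) * f 0" "\<And>i. i \<in> index_J X \<Longrightarrow> k i = 1" for k
    using that by blast
  have exc: ?thesis if "X \<in> {Aff_E6, Aff_E7, Aff_E8, Aff_F4, Aff_G2, Tw_E6, Tw_D4}"
    using kernel_exceptional[OF col that] .
  show ?thesis
  proof (cases X)
    case (Aff_A n)
    then have n: "1 \<le> n" using X by simp
    have c: "2 * f j - (if j = 0 then f n else f (j - 1))
      - (if j = n then f 0 else f (Suc j)) = 0" if "j \<le> n" for j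
      using col[of j] that n by (simp add: Aff_A col_sum_A)
    have c': "2 * f j - f (j - 1) - f (Suc j) = 0" if "0 < j" "j < n" for j
      using c[of j] that by simp
    have p: "f i = f 0 + real i * (f 1 - f 0)" if "i \<le> n" for i
    proof -
      have "f (0 + i) - (f 0 + real i *\<^sub>R (f (Suc 0) - f 0)) \<in> {0}"
        using that by (intro chain_progression[OF add_subgroup_0, where b = n]) (use c' in simp_all)
      then show ?thesis by simp
    qed
    have "real (n - 1) = real n - 1" using n by simp
    \<comment> \<open>Closing the cycle: inserting the progression into column \<open>n\<close>
      leaves \<open>n + 1\<close> times the common difference.\<close>
    then have "(real n + 1) * (f 1 - f 0) = 0"
      using c[of n] n p[of n] p[of "n - 1"] by (simp add: algebra_simps)
    then have "f 1 = f 0" by (simp add: add_eq_0_iff)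
    then have main: "f i = real 1 * f 0" if "i \<le> n" for i using p[OF that] by simp
    show ?thesis by (rule fin[of "\<lambda>_. 1"], rule main) (auto simp: Aff_A)
  next
    case (Aff_B n)
    then have n: "3 \<le> n" using X by simp
    have c: "2 * f j
      - (if j = 0 then f 2 else if j = 2 then f 0 + f 1 else if j = 1 then 0 else f (j - 1))
       - (if j = 0 \<or> j = n then 0 else if j = n - 1 then 2 *\<^sub>R f n else f (Suc j)) = 0"
         if "j \<le> n" for j
      using col[of j] that n by (simp add: Aff_B col_sum_B)
    have f12: "f 2 = 2 * f 0" "f 1 = f 0"
      using c[of 0] c[of 1] n by (auto simp: numeral_2_eq_2 split: if_splits)
    have mid: "f i = 2 * f 0" if "2 \<le> i" "i \<le> n - 1" for i
    proof -
      have "f i = f 2"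
      proof (rule chain_constant[where b = "n - 1"])
        show "2 * f j - f (j - 1) - f (Suc j) = 0" if "2 < j" "j < n - 1" for j
        proof -
          have "j \<le> n" using that by linarith
          from c[OF this] show ?thesis using that by (auto split: if_splits)
        qed
        show "f (Suc 2) = f 2" if "2 < n - 1"
          using c[of 2] that f12 n by (auto split: if_splits)
      qed (use that in auto)
      then show ?thesis using f12 by simp
    qed
    have "f n = f 0" using c[of n] mid[of "n - 1"] n by auto
    then have main: "f i = real (if i \<le> 1 \<or> i = n then 1 else 2) * f 0" if "i \<le> n" for i
      using that mid[of i] f12 by (cases "i = 0 \<or> i = 1 \<or> i = n") auto
    show ?thesis
      by (rule fin[of "\<lambda>i. if i \<le> 1 \<or> i = n then 1 else 2"], rule main) (auto simp: Aff_B)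
  next
    case (Aff_C n)
    then have n: "2 \<le> n" using X by simp
    have c: "2 * f j - (if j = 0 then 2 *\<^sub>R f 1 else if j = n then 2 *\<^sub>R f (n - 1) else f (j - 1))
       - (if j = 0 \<or> j = n then 0 else f (Suc j)) = 0" if "j \<le> n" for j
      using col[of j] that n by (simp add: Aff_C col_sum_C)
    have main: "f i = real 1 * f 0" if "i \<le> n" for i
    proof -
      have "f i = f 0"
      proof (rule chain_constant[where b = n])
        show "2 * f j - f (j - 1) - f (Suc j) = 0" if "0 < j" "j < n" for j
          using c[of j] that by simp
        show "f (Suc 0) = f 0" using c[of 0] by simp
      qed (use that in auto)
      then show ?thesis by simp
    qed
    show ?thesis by (rule fin[of "\<lambda>_. 1"], rule main) (auto simp: Aff_C)
  next
    case (Aff_D n)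
    then have n: "4 \<le> n" using X by simp
    have c: "2 * f j
      - (if j = 0 then f 2 else if j = 2 then f 0 + f 1 else if j = 1 then 0
        else if j = n then f (n - 2) else f (j - 1))
       - (if j = 0 \<or> j = n \<or> j = n - 1 then 0 else if j = n - 2 then f (n - 1) + f n
         else f (Suc j)) = 0" if "j \<le> n" for j
      using col[of j] that n by (simp add: Aff_D col_sum_D)
    have f12: "f 2 = 2 * f 0" "f 1 = f 0"
      using c[of 0] c[of 1] n by (auto simp: numeral_2_eq_2 split: if_splits)
    have mid: "f i = 2 * f 0" if "2 \<le> i" "i \<le> n - 2" for i
    proof -
      have "f i = f 2"
      proof (rule chain_constant[where b = "n - 2"])
        show "2 * f j - f (j - 1) - f (Suc j) = 0" if "2 < j" "j < n - 2" for j
        proof -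
          have "j \<le> n" using that by linarith
          from c[OF this] show ?thesis using that by (auto split: if_splits)
        qed
        show "f (Suc 2) = f 2" if "2 < n - 2"
          using c[of 2] that f12 n by (auto split: if_splits)
      qed (use that in auto)
      then show ?thesis using f12 by simp
    qed
    have e: "n - Suc (Suc 0) = n - 2" by simp
    have "f n = f 0" "f (n - 1) = f 0"
      using c[of n] c[of "n - 1"] mid[of "n - 2"] n by (auto simp: e split: if_splits)
    then have main: "f i = real (if i \<le> 1 \<or> n - 1 \<le> i then 1 else 2) * f 0" if "i \<le> n" for i
      using that mid[of i] f12 by (cases "i = 0 \<or> i = 1 \<or> i = n \<or> i = n - 1") auto
    show ?thesis
      by (rule fin[of "\<lambda>i. if i \<le> 1 \<or> n - 1 \<le> i then 1 else 2"], rule main) (auto simp: Aff_D)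
  next
    case (Tw_A_odd n)
    then have n: "3 \<le> n" using X by simp
    have c: "2 * f j
      - (if j = 0 then f 2 else if j = 2 then f 0 + f 1 else if j = 1 then 0
        else if j = n then 2 *\<^sub>R f (n - 1) else f (j - 1))
       - (if j = 0 \<or> j = n then 0 else f (Suc j)) = 0" if "j \<le> n" for j
      using col[of j] that n by (simp add: Tw_A_odd col_sum_A_odd)
    have f12: "f 2 = 2 * f 0" "f 1 = f 0"
      using c[of 0] c[of 1] n by (auto simp: numeral_2_eq_2 split: if_splits)
    have mid: "f i = 2 * f 0" if "2 \<le> i" "i \<le> n" for i
    proof -
      have "f i = f 2"
      proof (rule chain_constant[where b = n])
        show "2 * f j - f (j - 1) - f (Suc j) = 0" if "2 < j" "j < n" for j
          using c[of j] that by simp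
        show "f (Suc 2) = f 2" if "2 < n"
          using c[of 2] that f12 n by (auto split: if_splits)
      qed (use that in auto)
      then show ?thesis using f12 by simp
    qed
    have main: "f i = real (if i \<le> 1 then 1 else 2) * f 0" if "i \<le> n" for i
      using that mid[of i] f12 by (cases "i = 0 \<or> i = 1") auto
    show ?thesis by (rule fin[of "\<lambda>i. if i \<le> 1 then 1 else 2"], rule main) (auto simp: Tw_A_odd)
  next
    case (Tw_D n)
    then have n: "2 \<le> n" using X by simp
    have c: "2 * f j - (if j = 0 then f 1 else if j = 1 then 2 *\<^sub>R f 0 else f (j - 1))
       - (if j = 0 \<or> j = n then 0 else if j = n - 1 then 2 *\<^sub>R f n else f (Suc j)) = 0"
         if "j \<le> n" for j
      using col[of j] that n by (simp add: Tw_D col_sum_D_tw)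
    have f1: "f 1 = 2 * f 0" using c[of 0] n by auto
    have mid: "f i = 2 * f 0" if "1 \<le> i" "i \<le> n - 1" for i
    proof -
      have "f i = f 1"
      proof (rule chain_constant[where b = "n - 1"])
        show "2 * f j - f (j - 1) - f (Suc j) = 0" if "1 < j" "j < n - 1" for j
        proof -
          have "j \<le> n" using that by linarith
          from c[OF this] show ?thesis using that by (auto split: if_splits)
        qed
        show "f (Suc 1) = f 1" if "1 < n - 1"
          using c[of 1] that f1 n by (auto split: if_splits)
      qed (use that in auto)
      then show ?thesis using f1 by simp
    qed
    have "f n = f 0" using c[of n] mid[of "n - 1"] n by auto
    then have main: "f i = real (if i = 0 \<or> i = n then 1 else 2) * f 0" if "i \<le> n" for i
      using that mid[of i] by (cases "i = 0 \<or> i = n") auto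
    show ?thesis by (rule fin[of "\<lambda>i. if i = 0 \<or> i = n then 1 else 2"], rule main) (auto simp: Tw_D)
  qed (use X(2) exc in blast)+
qed

section \<open>Residues modulo the root lattice\<close>

lemma chain_from_zero:
  fixes f :: "nat \<Rightarrow> 'v::real_vector"
  assumes "add_subgroup Q" "f 0 = 0" "p \<le> b"
    and "\<And>j. 0 < j \<Longrightarrow> j < b \<Longrightarrow> 2 *\<^sub>R f j - f (j - 1) - f (Suc j) \<in> Q"
  shows "f p - real p *\<^sub>R f 1 \<in> Q"
  using chain_progression[OF assms(1,4), where a = 0 and b = b and i = p] assms(2,3) by simp

lemma residues_A:
  fixes f :: "nat \<Rightarrow> 'v::real_vector"
  assumes Q: "add_subgroup Q" and f0: "f 0 = 0" and n: "1 \<le> n"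
    and col: "\<And>j. j \<in> {1..n} \<Longrightarrow> col_sum (Aff_A n) f j \<in> Q"
  shows "\<exists>i\<in>{0..n}. (\<Sum>p\<in>{0..n}. of_int (k p) *\<^sub>R f p) - f i \<in> Q"
proof -
  have c: "2 *\<^sub>R f j - f (j - 1) - (if j = n then 0 else f (Suc j)) \<in> Q" if "0 < j" "j \<le> n" for j
    using col[of j] that n by (simp add: col_sum_A f0 split: if_splits)
  have gen: "f p - real p *\<^sub>R f 1 \<in> Q" if "p \<le> n" for p
    proof (rule chain_from_zero[where f = f, OF Q f0 that])
    show "2 *\<^sub>R f j - f (j - 1) - f (Suc j) \<in> Q" if "0 < j" "j < n" for j
      using c[of j] that by simp
  qed
  have "2 *\<^sub>R f n - f (n - 1) \<in> Q" using c[of n] n by simp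
  \<comment> \<open>Column \<open>n\<close> has no right neighbour because \<open>f 0 = 0\<close>;
    inserting the progression into it leaves \<open>n + 1\<close> times \<open>f 1\<close>.\<close>
  then have "2 *\<^sub>R f n - f (n - 1) - 2 *\<^sub>R (f n - real n *\<^sub>R f 1)
    + (f (n - 1) - real (n - 1) *\<^sub>R f 1) \<in> Q"
    using gen[of n] gen[of "n - 1"] add_subgroup_double[OF Q]
      add_subgroup_add[OF Q] add_subgroup_diff[OF Q] by (metis diff_le_self order_refl)
  also have "2 *\<^sub>R f n - f (n - 1) - 2 *\<^sub>R (f n - real n *\<^sub>R f 1) + (f (n - 1) - real (n - 1) *\<^sub>R f 1)
    = (2 * real n - real (n - 1)) *\<^sub>R f 1"
    by (simp add: algebra_simps)
  also have "2 * real n - real (n - 1) = real (Suc n)" using n by simp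
  finally have "real (Suc n) *\<^sub>R f 1 \<in> Q" .
  moreover have "\<exists>i\<in>{0..n}. f i - real r *\<^sub>R f 1 \<in> Q" if "r < Suc n" for r
    using gen[of r] that by (intro bexI[of _ r]) auto
  ultimately show ?thesis
    using gen by (intro cyclic_residue[OF Q, where N = "Suc n" and g = "f 1" and c = int]) simp_all
qed

text \<open>Shared by \<open>Aff_B\<close> and \<open>Tw_D\<close>, whose finite part is of type B,
  hence relations without the affine node. All weights but the spin weight \<open>f n\<close> lie in
  \<open>Q\<close>, and so does twice the spin weight.\<close>

lemma residues_B:
  fixes f :: "nat \<Rightarrow> 'v::real_vector"
  assumes Q: "add_subgroup Q" and f0: "f 0 = 0" and n: "2 \<le> n"
    and fn: "2 *\<^sub>R f n - f (n - 1) \<in> Q"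
    and pen: "2 *\<^sub>R f (n - 1) - f (n - 2) - 2 *\<^sub>R f n \<in> Q"
    and mid: "\<And>j. 0 < j \<Longrightarrow> j < n - 1 \<Longrightarrow> 2 *\<^sub>R f j - f (j - 1) - f (Suc j) \<in> Q"
  shows "\<exists>i\<in>{0, n}. (\<Sum>p\<in>{0..n}. of_int (k p) *\<^sub>R f p) - f i \<in> Q"
proof -
  have lin: "f p - real p *\<^sub>R f 1 \<in> Q" if "p \<le> n - 1" for p
    using mid by (intro chain_from_zero[where f = f, OF Q f0 that]) simp
  \<comment> \<open>The last two columns add up to the difference
    \<open>f (n - 1) - f (n - 2)\<close>, which is \<open>f 1\<close> modulo \<open>Q\<close> by the
    progression.\<close>
  have "2 *\<^sub>R f (n - 1) - f (n - 2) - 2 *\<^sub>R f n + (2 *\<^sub>R f n - f (n - 1))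
      - (f (n - 1) - real (n - 1) *\<^sub>R f 1) + (f (n - 2) - real (n - 2) *\<^sub>R f 1) \<in> Q"
    using lin[of "n - 1"] lin[of "n - 2"]
    by (intro add_subgroup_add[OF Q add_subgroup_diff[OF Q add_subgroup_add[OF Q pen fn]]]) simp_all
  also have "2 *\<^sub>R f (n - 1) - f (n - 2) - 2 *\<^sub>R f n + (2 *\<^sub>R f n - f (n - 1))
      - (f (n - 1) - real (n - 1) *\<^sub>R f 1) + (f (n - 2) - real (n - 2) *\<^sub>R f 1)
    = (real (n - 1) - real (n - 2)) *\<^sub>R f 1"
    by (simp add: algebra_simps scaleR_2)
  also have "real (n - 1) - real (n - 2) = 1" using n by simp
  finally have f1: "f 1 \<in> Q" by simp
  have gen: "f p \<in> Q" if "p \<le> n - 1" for p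
    using add_subgroup_add[OF Q lin[OF that] add_subgroup_scale_nat[OF Q f1, of p]] by simp
  have "2 *\<^sub>R f n \<in> Q"
    using add_subgroup_add[OF Q fn gen[of "n - 1"]] by simp
  then show ?thesis
    using gen f0 add_subgroup_zero[OF Q]
    by (intro cyclic_residue[OF Q, where N = 2 and g = "f n" and c = "\<lambda>p. if p = n then 1 else 0"])
       (auto simp: less_2_cases_iff)
qed

text \<open>Shared by \<open>Aff_C\<close> and \<open>Tw_A_odd\<close>, whose finite part is of type
  C. The column of the long root puts twice the common difference \<open>f 1\<close> into
  \<open>Q\<close>, so only a parity survives.\<close>

lemma residues_C:
  fixes f :: "nat \<Rightarrow> 'v::real_vector"
  assumes Q: "add_subgroup Q" and f0: "f 0 = 0" and n: "2 \<le> n"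
    and fn: "2 *\<^sub>R f n - 2 *\<^sub>R f (n - 1) \<in> Q"
    and mid: "\<And>j. 0 < j \<Longrightarrow> j < n \<Longrightarrow> 2 *\<^sub>R f j - f (j - 1) - f (Suc j) \<in> Q"
  shows "\<exists>i\<in>{0, 1}. (\<Sum>p\<in>{0..n}. of_int (k p) *\<^sub>R f p) - f i \<in> Q"
proof -
  have lin: "f p - real p *\<^sub>R f 1 \<in> Q" if "p \<le> n" for p
    using mid by (intro chain_from_zero[where f = f, OF Q f0 that]) simp
  have "2 *\<^sub>R f n - 2 *\<^sub>R f (n - 1) - 2 *\<^sub>R (f n - real n *\<^sub>R f 1)
      + 2 *\<^sub>R (f (n - 1) - real (n - 1) *\<^sub>R f 1) \<in> Q"
    using lin[of n] lin[of "n - 1"]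
    by (intro add_subgroup_add[OF Q add_subgroup_diff[OF Q fn]] add_subgroup_double[OF Q]) simp_all
  also have "2 *\<^sub>R f n - 2 *\<^sub>R f (n - 1) - 2 *\<^sub>R (f n - real n *\<^sub>R f 1)
      + 2 *\<^sub>R (f (n - 1) - real (n - 1) *\<^sub>R f 1) = (2 * real n - 2 * real (n - 1)) *\<^sub>R f 1"
    by (simp add: algebra_simps)
  also have "2 * real n - 2 * real (n - 1) = 2" using n by simp
  finally show ?thesis
    using lin f0 add_subgroup_zero[OF Q]
    by (intro cyclic_residue[OF Q, where N = 2 and g = "f 1" and c = int])
       (auto simp: less_2_cases_iff)
qed

text \<open>Node 0 has no row in the certificate and stands for residue 0, as \<open>f 0\<close>
  vanishes. Any other \<open>i\<close> stands for its entry of \<open>cs\<close> reduced modulo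
  \<open>N\<close>.\<close>

lemma residues_certified:
  fixes f :: "nat \<Rightarrow> 'v::real_vector"
  assumes Q: "add_subgroup Q" and f0: "f 0 = 0"
    and col: "\<And>j. j \<in> {1..rank X} \<Longrightarrow> col_sum X f j \<in> Q"
    and K: "residue_certificate X g cs K" and g: "g \<in> {1..rank X}"
    and N: "cs ! (g - 1) = 1 - int N" "0 < N"
    and J: "\<And>r. r < N \<Longrightarrow> \<exists>i\<in>J. i = 0 \<and> r = 0 \<or> i \<in> {1..rank X} \<and> r = nat (cs ! (i - 1) mod int N)"
  shows "\<exists>i\<in>J. (\<Sum>p\<in>{0..rank X}. of_int (k p) *\<^sub>R f p) - f i \<in> Q"
proof -
  have cert: "f q - of_int (cs ! (q - 1)) *\<^sub>R f g \<in> Q" if "q \<in> {1..rank X}" for q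
    using col by (intro certified_residue[where f = f, OF Q f0 _ K g that]) simp
  have Ng: "real N *\<^sub>R f g \<in> Q"
    using cert[OF g] N by (simp add: scaleR_diff_left)
  show ?thesis
  proof (rule cyclic_residue[OF Q _ Ng N(2), where c = "\<lambda>p. if p = 0 then 0 else cs ! (p - 1)"])
    fix p assume "p \<le> rank X"
    then show "f p - of_int (if p = 0 then 0 else cs ! (p - 1)) *\<^sub>R f g \<in> Q"
      using cert[of p] f0 add_subgroup_zero[OF Q] by (cases "p = 0") auto
  next
    fix r assume "r < N"
    then obtain i where i: "i \<in> J" "i = 0 \<and> r = 0 \<or> i \<in> {1..rank X}
      \<and> r = nat (cs ! (i - 1) mod int N)"
      using J by blast
    from i(2) have "f i - real r *\<^sub>R f g \<in> Q"
    proof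
      assume "i = 0 \<and> r = 0"
      then show ?thesis using f0 add_subgroup_zero[OF Q] by simp
    next
      let ?c = "cs ! (i - 1)"
      assume "i \<in> {1..rank X} \<and> r = nat (?c mod int N)"
      then have i': "i \<in> {1..rank X}" and "int r = ?c mod int N" using N(2) by auto
      then have "?c = int r + (?c div int N) * int N" by simp
      then have "real_of_int ?c = real r + of_int (?c div int N) * real N"
        by (metis of_int_add of_int_mult of_int_of_nat_eq)
      then have eq: "f i - real r *\<^sub>R f g
        = f i - of_int ?c *\<^sub>R f g + of_int (?c div int N) *\<^sub>R real N *\<^sub>R f g"
        by (simp add: scaleR_add_left)
      show ?thesis
        unfolding eq by (rule add_subgroup_add[OF Q cert[OF i'] add_subgroup_scale_int[OF Q Ng]])
    qed
    then show "\<exists>i\<in>J. f i - real r *\<^sub>R f g \<in> Q" using i(1) by blast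
  qed
qed

text \<open>The weight lattice modulo the root lattice is a Klein four-group for even
  \<open>n\<close>, so \<open>cyclic_residue\<close> does not fit. Two generators are kept, the
  vector weight \<open>f 1\<close> and the spin weight \<open>f n\<close>, with
  \<open>2 f 1 = 0\<close> and \<open>2 f n = (n - 2) f 1\<close> modulo \<open>Q\<close>.\<close>

lemma residues_D:
  fixes f :: "nat \<Rightarrow> 'v::real_vector"
  assumes Q: "add_subgroup Q" and f0: "f 0 = 0" and n: "4 \<le> n"
    and col: "\<And>j. j \<in> {1..n} \<Longrightarrow> col_sum (Aff_D n) f j \<in> Q"
  shows "\<exists>i\<in>{0, 1, n - 1, n}. (\<Sum>p\<in>{0..n}. of_int (k p) *\<^sub>R f p) - f i \<in> Q"
proof -
  \<comment> \<open>The fork is node \<open>m + 1\<close>; the two spin nodes are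
    \<open>m + 2\<close> and \<open>n\<close>.\<close>
  define m where "m = n - 3"
  have m: "n = m + 3" "1 \<le> m" using n by (auto simp: m_def)
  have c: "2 *\<^sub>R f j - f (j - 1) - f (Suc j) \<in> Q" if "0 < j" "j < m + 1" for j
    using col[of j] that m by (auto simp: col_sum_D f0 split: if_splits)
  have r1: "2 *\<^sub>R f (m + 1) - f m - f (m + 2) - f n \<in> Q"
    using col[of "m + 1"] m by (auto simp: col_sum_D f0 algebra_simps split: if_splits)
  have r2: "2 *\<^sub>R f (m + 2) - f (m + 1) \<in> Q"
    using col[of "m + 2"] m by (auto simp: col_sum_D)
  have r3: "2 *\<^sub>R f n - f (m + 1) \<in> Q"
    using col[of n] m by (auto simp: col_sum_D)
  have lin: "f p - real p *\<^sub>R f 1 \<in> Q" if "p \<le> m + 1" for p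
    using c by (intro chain_from_zero[where f = f, OF Q f0 that]) simp
  have s3: "2 *\<^sub>R f n - real (m + 1) *\<^sub>R f 1 \<in> Q"
    using add_subgroup_trans[OF Q r3 lin] by simp
  have s2: "2 *\<^sub>R f (m + 2) - real (m + 1) *\<^sub>R f 1 \<in> Q"
    using add_subgroup_trans[OF Q r2 lin] by simp
  have "2 *\<^sub>R (f (m + 1) - real (m + 1) *\<^sub>R f 1) - (f m - real m *\<^sub>R f 1)
      - (2 *\<^sub>R f (m + 1) - f m - f (m + 2) - f n) \<in> Q"
    using lin[of m] lin[of "m + 1"]
    by (intro add_subgroup_diff[OF Q add_subgroup_diff[OF Q add_subgroup_double[OF Q]] r1]) simp_all
  also have "2 *\<^sub>R (f (m + 1) - real (m + 1) *\<^sub>R f 1) - (f m - real m *\<^sub>R f 1)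
      - (2 *\<^sub>R f (m + 1) - f m - f (m + 2) - f n) = f (m + 2) - (real (m + 2) *\<^sub>R f 1 - f n)"
    by (simp add: algebra_simps scaleR_2, simp only: mult_2_right scaleR_add_left add_ac)
  finally have s1: "f (m + 2) - (real (m + 2) *\<^sub>R f 1 - f n) \<in> Q" .
  \<comment> \<open>Adding both doubled spin relations and subtracting twice the relation
    \<open>s1\<close> for their sum cancels the spin weights.\<close>
  have "(2 *\<^sub>R f (m + 2) - real (m + 1) *\<^sub>R f 1) + (2 *\<^sub>R f n - real (m + 1) *\<^sub>R f 1)
      - 2 *\<^sub>R (f (m + 2) - (real (m + 2) *\<^sub>R f 1 - f n)) \<in> Q"
    by (rule add_subgroup_diff[OF Q add_subgroup_add[OF Q s2 s3] add_subgroup_double[OF Q s1]])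
  also have "(2 *\<^sub>R f (m + 2) - real (m + 1) *\<^sub>R f 1) + (2 *\<^sub>R f n - real (m + 1) *\<^sub>R f 1)
      - 2 *\<^sub>R (f (m + 2) - (real (m + 2) *\<^sub>R f 1 - f n)) = 2 *\<^sub>R f 1"
    by (simp add: algebra_simps scaleR_2, simp only: mult_2_right scaleR_add_left)
  finally have two: "2 *\<^sub>R f 1 \<in> Q" .
  \<comment> \<open>Coordinates of \<open>f p\<close> in the generators \<open>f 1\<close> and
    \<open>f n\<close>; the other spin node gets its pair from \<open>s1\<close>.\<close>
  define c d where "c p = (if p \<le> m + 2 then int p else 0)"
    and "d p = (if p \<le> m + 1 then 0 else if p = m + 2 then -1 else (1::int))" for p
  have gen: "f p - (of_int (c p) *\<^sub>R f 1 + of_int (d p) *\<^sub>R f n) \<in> Q" if p: "p \<le> n" for p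
  proof -
    consider "p \<le> m + 1" | "p = m + 2" | "p = n" using p m by linarith
    then show ?thesis
      by cases (use lin s1 m add_subgroup_zero[OF Q] in \<open>auto simp: c_def d_def\<close>)
  qed
  define K L where "K = (\<Sum>p\<in>{0..n}. k p * c p)" and "L = (\<Sum>p\<in>{0..n}. k p * d p)"
  let ?x = "\<Sum>p\<in>{0..n}. of_int (k p) *\<^sub>R f p"
  have "(\<Sum>p\<in>{0..n}. of_int (k p) *\<^sub>R (f p - (of_int (c p) *\<^sub>R f 1 + of_int (d p) *\<^sub>R f n))) \<in> Q"
    using gen by (intro add_subgroup_sum add_subgroup_scale_int Q) auto
  also have "(\<Sum>p\<in>{0..n}. of_int (k p) *\<^sub>R (f p - (of_int (c p) *\<^sub>R f 1 + of_int (d p) *\<^sub>R f n)))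
      = ?x - (of_int K *\<^sub>R f 1 + of_int L *\<^sub>R f n)"
    by (simp add: K_def L_def sum_subtractf sum.distrib scaleR_diff_right scaleR_add_right scaleR_left.sum)
  finally have x1: "?x - (of_int K *\<^sub>R f 1 + of_int L *\<^sub>R f n) \<in> Q" .
  \<comment> \<open>Each pair of copies of \<open>f n\<close> is traded by \<open>s3\<close> for
    \<open>m + 1\<close> copies of \<open>f 1\<close>, so both coefficients can be reduced to
    parities.\<close>
  define M where "M = K + (L div 2) * int (m + 1)"
  have half: "real_of_int z = 2 * of_int (z div 2) + of_int (z mod 2)" for z
    by (metis mult_div_mod_eq of_int_add of_int_mult of_int_numeral)
  note L = half[of L] and M = half[of M]
  have KM: "real_of_int K = of_int M - of_int (L div 2) * real (m + 1)"
    by (simp add: M_def)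
  have "of_int (L div 2) *\<^sub>R (2 *\<^sub>R f n - real (m + 1) *\<^sub>R f 1) + of_int (M div 2) *\<^sub>R 2 *\<^sub>R f 1 \<in> Q"
    by (intro add_subgroup_add add_subgroup_scale_int Q s3 two)
  also have "of_int (L div 2) *\<^sub>R (2 *\<^sub>R f n - real (m + 1) *\<^sub>R f 1) + of_int (M div 2) *\<^sub>R 2 *\<^sub>R f 1
      = (of_int K *\<^sub>R f 1 + of_int L *\<^sub>R f n) - (of_int (M mod 2) *\<^sub>R f 1 + of_int (L mod 2) *\<^sub>R f n)"
    unfolding KM L by (subst M) (simp add: algebra_simps)
  finally have x2: "?x - (of_int (M mod 2) *\<^sub>R f 1 + of_int (L mod 2) *\<^sub>R f n) \<in> Q"
    using add_subgroup_trans[OF Q x1] by blast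
  have "\<exists>i\<in>{0, 1, n - 1, n}. (of_int (M mod 2) *\<^sub>R f 1 + of_int (L mod 2) *\<^sub>R f n) - f i \<in> Q"
  proof -
    have z: "0 \<in> Q" using add_subgroup_zero[OF Q] .
    \<comment> \<open>The parity pair (1, 1) is represented by node \<open>n - 1\<close>: vector
      plus spin weight is the other spin weight modulo \<open>Q\<close>.\<close>
    have "(2 *\<^sub>R f n - real (m + 1) *\<^sub>R f 1) - (f (m + 2) - (real (m + 2) *\<^sub>R f 1 - f n)) \<in> Q"
      by (rule add_subgroup_diff[OF Q s3 s1])
    also have "(2 *\<^sub>R f n - real (m + 1) *\<^sub>R f 1) - (f (m + 2) - (real (m + 2) *\<^sub>R f 1 - f n))
       = f 1 + f n - f (m + 2)"
      by (simp add: algebra_simps scaleR_2)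
    finally have "f 1 + f n - f (n - 1) \<in> Q" using m by simp
    moreover have "M mod 2 = 0 \<or> M mod 2 = 1" "L mod 2 = 0 \<or> L mod 2 = 1" by auto
    ultimately show ?thesis using z f0 by auto
  qed
  then show ?thesis using add_subgroup_trans[OF Q x2] by blast
qed

text \<open>\<open>Q\<close> stays arbitrary because the result is used twice: modulo
  \<open>Q0 D\<close> for the classes, and modulo \<open>h0_dual D\<close> to show that projected
  weights lie in that subspace.\<close>

lemma residue_representative:
  fixes f :: "nat \<Rightarrow> 'v::real_vector"
  assumes X: "valid_type X" "\<nexists>n. X = Tw_A_even n" and Q: "add_subgroup Q" and f0: "f 0 = 0"
    and col: "\<And>j. j \<in> {1..rank X} \<Longrightarrow> col_sum X f j \<in> Q"
  shows "\<exists>i\<in>index_J X. (\<Sum>p\<in>{0..rank X}. of_int (k p) *\<^sub>R f p) - f i \<in> Q"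
proof (cases X)
  case (Aff_A n)
  then show ?thesis using X col residues_A[where f = f, OF Q f0, of n k] by simp
next
  case (Aff_B n)
  then have n: "3 \<le> n" using X by simp
  have "\<exists>i\<in>{0, n}. (\<Sum>p\<in>{0..n}. of_int (k p) *\<^sub>R f p) - f i \<in> Q"
  proof (rule residues_B[where f = f, OF Q f0])
    show "2 *\<^sub>R f n - f (n - 1) \<in> Q" using col[of n] n by (simp add: Aff_B col_sum_B)
    show "2 *\<^sub>R f (n - 1) - f (n - 2) - 2 *\<^sub>R f n \<in> Q"
    proof -
      define m where "m = n - 3"
      have "n = m + 3" using n by (simp add: m_def)
      then show ?thesis using col[of "m + 2"] f0
        by (auto simp: Aff_B col_sum_B eval_nat_numeral split: if_splits)
    qed
    show "2 *\<^sub>R f j - f (j - 1) - f (Suc j) \<in> Q" if "0 < j" "j < n - 1" for j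
    proof -
      have "j \<in> {1..rank X}" using that by (simp add: Aff_B)
      from col[OF this] show ?thesis
        using that n f0 by (auto simp: Aff_B col_sum_B split: if_splits)
    qed
  qed (use n in simp)
  then show ?thesis by (simp add: Aff_B)
next
  case (Tw_D n)
  then have n: "2 \<le> n" using X by simp
  have "\<exists>i\<in>{0, n}. (\<Sum>p\<in>{0..n}. of_int (k p) *\<^sub>R f p) - f i \<in> Q"
  proof (rule residues_B[where f = f, OF Q f0])
    show "2 *\<^sub>R f n - f (n - 1) \<in> Q" using col[of n] n by (simp add: Tw_D col_sum_D_tw)
    show "2 *\<^sub>R f (n - 1) - f (n - 2) - 2 *\<^sub>R f n \<in> Q"
    proof -
      define m where "m = n - 2"
      have "n = m + 2" using n by (simp add: m_def)
      then show ?thesis using col[of "m + 1"] f0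
        by (auto simp: Tw_D col_sum_D_tw eval_nat_numeral split: if_splits)
    qed
    show "2 *\<^sub>R f j - f (j - 1) - f (Suc j) \<in> Q" if "0 < j" "j < n - 1" for j
    proof -
      have "j \<in> {1..rank X}" using that by (simp add: Tw_D)
      from col[OF this] show ?thesis
        using that n f0 by (auto simp: Tw_D col_sum_D_tw split: if_splits)
    qed
  qed (use n in simp)
  then show ?thesis by (simp add: Tw_D)
next
  case (Aff_C n)
  then have n: "2 \<le> n" using X by simp
  have "\<exists>i\<in>{0, 1}. (\<Sum>p\<in>{0..n}. of_int (k p) *\<^sub>R f p) - f i \<in> Q"
  proof (rule residues_C[where f = f, OF Q f0])
    show "2 *\<^sub>R f n - 2 *\<^sub>R f (n - 1) \<in> Q" using col[of n] n by (simp add: Aff_C col_sum_C)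
    show "2 *\<^sub>R f j - f (j - 1) - f (Suc j) \<in> Q" if "0 < j" "j < n" for j
    proof -
      have "j \<in> {1..rank X}" using that by (simp add: Aff_C)
      from col[OF this] show ?thesis
        using that n f0 by (auto simp: Aff_C col_sum_C split: if_splits)
    qed
  qed (use n in simp)
  then show ?thesis by (simp add: Aff_C)
next
  case (Tw_A_odd n)
  then have n: "3 \<le> n" using X by simp
  have "\<exists>i\<in>{0, 1}. (\<Sum>p\<in>{0..n}. of_int (k p) *\<^sub>R f p) - f i \<in> Q"
  proof (rule residues_C[where f = f, OF Q f0])
    show "2 *\<^sub>R f n - 2 *\<^sub>R f (n - 1) \<in> Q" using col[of n] n by (simp add: Tw_A_odd col_sum_A_odd)
    show "2 *\<^sub>R f j - f (j - 1) - f (Suc j) \<in> Q" if "0 < j" "j < n" for j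
    proof -
      have "j \<in> {1..rank X}" using that by (simp add: Tw_A_odd)
      from col[OF this] show ?thesis
        using that n f0 by (auto simp: Tw_A_odd col_sum_A_odd split: if_splits)
    qed
  qed (use n in simp)
  then show ?thesis by (simp add: Tw_A_odd)
next
  case (Aff_D n)
  then show ?thesis using X col residues_D[where f = f, OF Q f0, of n k] by simp
next
  case Aff_E6
  show ?thesis
    by (rule residues_certified[where f = f, OF Q f0 col, where N
      = 3, OF _ certificate_Aff_E6[folded Aff_E6]])
       (auto simp: Aff_E6 less_Suc_eq numeral_3_eq_3)
next
  case Aff_E7
  show ?thesis
    by (rule residues_certified[where f = f, OF Q f0 col, where N
      = 2, OF _ certificate_Aff_E7[folded Aff_E7]])
       (auto simp: Aff_E7 less_Suc_eq numeral_2_eq_2)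
next
  case Aff_E8
  show ?thesis
    by (rule residues_certified[where f = f, OF Q f0 col, where N
      = 1, OF _ certificate_Aff_E8[folded Aff_E8]])
       (auto simp: Aff_E8)
next
  case Aff_F4
  show ?thesis
    by (rule residues_certified[where f = f, OF Q f0 col, where N
      = 1, OF _ certificate_Aff_F4[folded Aff_F4]])
       (auto simp: Aff_F4)
next
  case Aff_G2
  show ?thesis
    by (rule residues_certified[where f = f, OF Q f0 col, where N
      = 1, OF _ certificate_Aff_G2[folded Aff_G2]])
       (auto simp: Aff_G2)
next
  case Tw_E6
  show ?thesis
    by (rule residues_certified[where f = f, OF Q f0 col, where N
      = 1, OF _ certificate_Tw_E6[folded Tw_E6]])
       (auto simp: Tw_E6)
next
  case Tw_D4
  show ?thesis
    by (rule residues_certified[where f = f, OF Q f0 col, where N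
      = 1, OF _ certificate_Tw_D4[folded Tw_D4]])
       (auto simp: Tw_D4)
qed (use X in simp)

section \<open>Coweights separating the residues\<close>

lemma half_not_int: "(1 / 2 :: real) \<notin> \<int>" "- (1 / 2 :: real) \<notin> \<int>"
proof -
  show "(1 / 2 :: real) \<notin> \<int>"
    using of_int_div_of_int_in_Ints_iff[of 1 2, where ?'a = real] by simp
  then show "- (1 / 2 :: real) \<notin> \<int>" by simp
qed

text \<open>Four classes need two functionals. In the usual coordinates they are the coweights
  \<open>e_1\<close>, taken modulo integers, which splits vector from spin type, and
  \<open>(e_1 + ... + e_n) / 2\<close>, which splits each of these pairs.\<close>

lemma separation_D:
  assumes n: "4 \<le> n" and i: "i \<in> {0, 1, n - 1, n}" "i' \<in> {0, 1, n - 1, n}" "i \<noteq> i'"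
  shows "\<exists>f::nat\<Rightarrow>real. f 0 = 0 \<and> (\<forall>j\<in>{1..n}. col_sum (Aff_D n) f j \<in> \<int>) \<and> f i - f i' \<notin> \<int>"
proof (cases "i \<in> {0, 1} \<longleftrightarrow> i' \<in> {0, 1}")
  case False
  define f :: "nat \<Rightarrow> real" where "f p = (if p = n \<or> p = n - 1 then 1 / 2 else 0)" for p
  have "f 0 = 0" using n by (simp add: f_def)
  moreover have "col_sum (Aff_D n) f j \<in> \<int>" if j: "j \<in> {1..n}" for j
  proof -
    define m where "m = n - 3"
    have m: "n = m + 3" "1 \<le> m" using n by (auto simp: m_def)
    consider "j = 1" | "j = 2" "j < m + 1" | "2 < j" "j < m + 1" | "1 < j" "j = m + 1"
      | "j = m + 2" | "j = m + 3"
      using j m by fastforce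
    then show ?thesis
    proof cases
      case 4
      \<comment> \<open>For \<open>n = 4\<close> the fork is node 2, which is also adjacent to node
        0.\<close>
      then show ?thesis using m by (cases "m = 1") (simp_all add: col_sum_D f_def)
    next
      case 3
      then have "j - 1 \<noteq> n" "j - 1 \<noteq> n - 1" using m by auto
      with 3 show ?thesis using m by (simp add: col_sum_D f_def)
    qed (use m in \<open>simp_all add: col_sum_D f_def\<close>)
  qed
  moreover have "f i - f i' \<notin> \<int>"
  proof -
    have v: "f p = (if p \<in> {0, 1} then 0 else 1 / 2)" if "p \<in> {0, 1, n - 1, n}" for p
      using that n by (auto simp: f_def)
    have "f i - f i' = 1 / 2 \<or> f i - f i' = - (1 / 2)"
      using False v[OF i(1)] v[OF i(2)] by simp
    then show ?thesis using half_not_int by metis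
  qed
  ultimately show ?thesis by blast
next
  case True
  define f :: "nat \<Rightarrow> real"
    where "f p = (if p \<le> n - 2 then real p / 2 else if p = n - 1 then (real n - 2) / 4
      else real n / 4)" for p
  have "f 0 = 0" by (simp add: f_def)
  moreover have "col_sum (Aff_D n) f j \<in> \<int>" if j: "j \<in> {1..n}" for j
  proof -
    define m where "m = n - 3"
    have m: "n = m + 3" "1 \<le> m" using n by (auto simp: m_def)
    consider "j = 1" | "j = 2" "j < m + 1" | "2 < j" "j < m + 1" | "1 < j" "j = m + 1"
      | "j = m + 2" | "j = m + 3"
      using j m by fastforce
    then show ?thesis
    proof cases
      case 3
      then have "real (j - 1) = real j - 1" "j - 1 \<le> n - 2" using m by simp_all
      with 3 show ?thesis using m by (simp add: col_sum_D f_def field_simps)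
    next
      case 4
      then show ?thesis using m by (cases "m = 1") (simp_all add: col_sum_D f_def field_simps)
    qed (use m in \<open>simp_all add: col_sum_D f_def field_simps\<close>)
  qed
  moreover have "f i - f i' \<notin> \<int>"
  proof -
    have "\<not> n - 1 \<le> n - 2" "\<not> n \<le> n - 2" "n \<noteq> n - 1" using n by auto
    then have "f n - f (n - 1) = 1 / 2" "f 1 - f 0 = 1 / 2"
      using n by (simp_all add: f_def field_simps)
    moreover have "i \<in> {0, 1} \<and> i' \<in> {0, 1} \<or> i \<in> {n - 1, n} \<and> i' \<in> {n - 1, n}"
      using True i(1,2) by blast
    ultimately have "f i - f i' = 1 / 2 \<or> f i - f i' = - (1 / 2)"
      using i(3) by (elim disjE) fastforce+
    then show ?thesis using half_not_int by metis
  qed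
  ultimately show ?thesis by blast
qed

text \<open>\<open>f\<close> records on the fundamental weights a coweight, that is, a functional
  integral on the roots; it tells classes apart modulo integers. In type A it is the last
  fundamental coweight, and for two classes it takes half-integral values. With
  \<open>index_J X = {0}\<close> there is no pair to separate.\<close>

lemma residue_separation:
  assumes X: "valid_type X" "\<nexists>n. X = Tw_A_even n"
    and i: "i \<in> index_J X" "i' \<in> index_J X" "i \<noteq> i'"
  shows "\<exists>f::nat\<Rightarrow>real. f 0 = 0 \<and> (\<forall>j\<in>{1..rank X}. col_sum X f j \<in> \<int>) \<and> f i - f i' \<notin> \<int>"
proof -
  have fin: ?thesis
    if "f 0 = 0" "index_J X = {0, p}" "f p = 1 / 2" "\<And>j. 1 \<le> j \<Longrightarrow> j \<le> rank X \<Longrightarrow> col_sum X f j \<in> \<int>"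
    for f :: "nat \<Rightarrow> real" and p
  proof (intro exI[of _ f] conjI ballI)
    have "f i - f i' = 1 / 2 \<or> f i - f i' = - (1 / 2)" using that(1-3) i by auto
    then show "f i - f i' \<notin> \<int>" using half_not_int by metis
  qed (use that in auto)
  show ?thesis
  proof (cases X)
    case (Aff_A n)
    then have n: "1 \<le> n" using X by simp
    define f :: "nat \<Rightarrow> real" where "f p = real p / real (n + 1)" for p
    have "f 0 = 0" by (simp add: f_def)
    moreover have "col_sum X f j \<in> \<int>" if "j \<in> {1..rank X}" for j
    proof -
      have j: "1 \<le> j" "j \<le> n" using that Aff_A by auto
      then have "real (j - 1) = real j - 1" by simp
      then have "col_sum X f j = (2 * real j - (real j - 1)
        - (if j = n then 0 else real j + 1)) / real (n + 1)"
        using j n by (simp add: Aff_A col_sum_A f_def diff_divide_distrib add_divide_distrib)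
      then have "col_sum X f j = (if j = n then 1 else 0)"
        by (simp add: add.commute)
      then show ?thesis by simp
    qed
    moreover have "f i - f i' \<notin> \<int>"
    proof -
      have "\<not> int (n + 1) dvd int i - int i'"
      proof
        assume "int (n + 1) dvd int i - int i'"
        then have "int (n + 1) \<le> \<bar>int i - int i'\<bar>" using i(3) by (intro zdvd_imp_le) auto
        then show False using i Aff_A by auto
      qed
      then have "of_int (int i - int i') / of_int (int (n + 1)) \<notin> (\<int> :: real set)"
        by (subst of_int_div_of_int_in_Ints_iff) simp
      then show ?thesis by (simp add: f_def diff_divide_distrib)
    qed
    ultimately show ?thesis by blast
  next
    case (Aff_B n)
    then have n: "3 \<le> n" using X by simp
    show ?thesis
      by (rule fin[of "\<lambda>p. if p = n then 1 / 2 else 0" n]) (use n in \<open>auto simp: Aff_B col_sum_B\<close>)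
  next
    case (Tw_D n)
    then have n: "2 \<le> n" using X by simp
    show ?thesis
      by (rule fin[of "\<lambda>p. if p = n then 1 / 2 else 0" n]) (use n in \<open>auto simp: Tw_D col_sum_D_tw\<close>)
  next
    case (Aff_C n)
    then have n: "2 \<le> n" using X by simp
    have "col_sum X (\<lambda>p. real p / 2) j = (if j = n then 1 else 0)" if "1 \<le> j" "j \<le> n" for j
      using that n by (auto simp: Aff_C col_sum_C of_nat_diff field_simps)
    then show ?thesis
      by (intro fin[of "\<lambda>p. real p / 2" 1]) (simp_all add: Aff_C)
  next
    case (Tw_A_odd n)
    then have n: "3 \<le> n" using X by simp
    have "col_sum X (\<lambda>p. real p / 2) j = (if j = n then 1 else 0)" if "1 \<le> j" "j \<le> n" for j
      using that n by (auto simp: Tw_A_odd col_sum_A_odd of_nat_diff field_simps)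
    then show ?thesis
      by (intro fin[of "\<lambda>p. real p / 2" 1]) (simp_all add: Tw_A_odd)
  next
    case (Aff_D n)
    then show ?thesis using X i separation_D[of n i i'] by simp
  next
    case Aff_E6
    \<comment> \<open>The numerators are the residues of \<open>certificate_Aff_E6\<close> modulo 3,
      preceded by 0 for the affine node.\<close>
    define f :: "nat \<Rightarrow> real" where "f p = real ([0, 1, 0, 2, 0, 1, 2] ! p) / 3" for p
    have "f 0 = 0" by (simp add: f_def)
    moreover have "col_sum X f j \<in> \<int>" if "j \<in> {1..rank X}" for j
    proof -
      have "j = 1 \<or> j = 2 \<or> j = 3 \<or> j = 4 \<or> j = 5 \<or> j = 6" using that Aff_E6 by auto
      then show ?thesis by (elim disjE) (simp_all add: Aff_E6 col_sum_edges f_def)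
    qed
    moreover have "f i - f i' \<notin> \<int>"
    proof -
      have "of_int k / of_int 3 \<notin> (\<int> :: real set)" if "k \<in> {1, -1, 2, -2}" for k
        using that by (subst of_int_div_of_int_in_Ints_iff) auto
      from this[of 1] this[of "-1"] this[of 2] this[of "-2"]
      show ?thesis using i Aff_E6 by (auto simp: f_def)
    qed
    ultimately show ?thesis by blast
  next
    case Aff_E7
    show ?thesis
    \<comment> \<open>Nodes 2, 5 and 7 are those of odd residue in
      \<open>certificate_Aff_E7\<close>.\<close>
    proof (rule fin[of "\<lambda>p. if p \<in> {2, 5, 7} then 1 / 2 else 0" 7])
      fix j assume "1 \<le> j" "j \<le> rank X"
      then have "j = 1 \<or> j = 2 \<or> j = 3 \<or> j = 4 \<or> j = 5 \<or> j = 6 \<or> j = 7" using Aff_E7 by auto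
      then show "col_sum X (\<lambda>p. if p \<in> {2, 5, 7} then 1 / 2 else 0 :: real) j \<in> \<int>"
        by (elim disjE) (simp_all add: Aff_E7 col_sum_edges)
    qed (simp_all add: Aff_E7)
  qed (use X i in auto)
qed

lemma index_J_range:
  assumes "valid_type X" "\<nexists>n. X = Tw_A_even n"
  shows "index_J X \<subseteq> {0..rank X}"
  using assms by (cases X) auto

section \<open>The weight lattice of an affine datum\<close>

lemma add_subgroup_int_span: "add_subgroup (int_span f I)"
  unfolding add_subgroup_def int_span_def
proof (intro conjI ballI)
  show "0 \<in> {\<Sum>i\<in>I. of_int (k i) *\<^sub>R f i | k :: nat \<Rightarrow> int. True}"
    by (auto intro!: exI[of _ "\<lambda>_. 0"])
next
  fix x y
  assume "x \<in> {\<Sum>i\<in>I. of_int (k i) *\<^sub>R f i | k :: nat \<Rightarrow> int. True}"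
    and "y \<in> {\<Sum>i\<in>I. of_int (k i) *\<^sub>R f i | k :: nat \<Rightarrow> int. True}"
  then obtain k m :: "nat \<Rightarrow> int"
    where "x = (\<Sum>i\<in>I. of_int (k i) *\<^sub>R f i)" "y = (\<Sum>i\<in>I. of_int (m i) *\<^sub>R f i)" by auto
  then have "x - y = (\<Sum>i\<in>I. of_int (k i - m i) *\<^sub>R f i)"
    by (simp add: sum_subtractf scaleR_diff_left)
  then show "x - y \<in> {\<Sum>i\<in>I. of_int (k i) *\<^sub>R f i | k :: nat \<Rightarrow> int. True}"
    by (auto intro!: exI[of _ "\<lambda>i. k i - m i"])
qed

lemma int_spanI: "(\<Sum>i\<in>I. of_int (k i) *\<^sub>R f i) \<in> int_span f I"
  by (auto simp: int_span_def)

lemma int_span_base: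
  assumes "finite I" "i \<in> I"
  shows "f i \<in> int_span f I"
proof -
  have "(\<Sum>j\<in>I. of_int (if j = i then 1 else 0) *\<^sub>R f j) = (\<Sum>j\<in>I. if j = i then f j else 0)"
    by (intro sum.cong) auto
  then have "f i = (\<Sum>j\<in>I. of_int (if j = i then 1 else 0) *\<^sub>R f j)" using assms by simp
  then show ?thesis unfolding int_span_def by (auto intro!: exI[of _ "\<lambda>j. if j = i then 1 else 0"])
qed

lemma quotient_card_representatives:
  assumes A: "equiv A r" and R: "complete_representatives A r R" "finite R"
  shows "finite (A // r) \<and> card (A // r) = card R"
proof -
  have "A // r = (\<lambda>x. r `` {x}) ` R"
  proof (intro equalityI subsetI)
    fix c assume "c \<in> A // r"
    then obtain x where x: "x \<in> A" "c = r `` {x}" by (auto elim: quotientE)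
    then obtain y where "y \<in> R" "(x, y) \<in> r"
      using R(1) unfolding complete_representatives_def by blast
    then show "c \<in> (\<lambda>x. r `` {x}) ` R" using x equiv_class_eq[OF A] by blast
  next
    fix c assume "c \<in> (\<lambda>x. r `` {x}) ` R"
    then show "c \<in> A // r"
      using R(1) unfolding complete_representatives_def by (auto intro: quotientI)
  qed
  moreover have "inj_on (\<lambda>x. r `` {x}) R"
  proof (rule inj_onI)
    fix x y assume xy: "x \<in> R" "y \<in> R" "r `` {x} = r `` {y}"
    then have "(x, y) \<in> r"
      using R(1) eq_equiv_class[OF _ A] unfolding complete_representatives_def by blast
    then show "x = y" using R(1) xy unfolding complete_representatives_def by blast
  qed
  ultimately show ?thesis using R(2) by (simp add: card_image)
qed

locale affine_lattice =
  fixes D :: "'v::real_vector affine_datum"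
  assumes datum: "is_affine_datum D" and not_A_even: "\<nexists>n. kind D = Tw_A_even n"
begin

abbreviation "n \<equiv> rk D"
abbreviation "J \<equiv> index_J (kind D)"
abbreviation "w i \<equiv> proj D (fundwt D i)"

lemma datum_conjuncts:
  "valid_type (kind D)"
  "\<forall>i\<in>{0..n}. 0 < mark D i \<and> 0 < comark D i"
  "Gcd (mark D ` {0..n}) = 1"
  "Gcd (comark D ` {0..n}) = 1"
  "\<forall>i\<in>{0..n}. (\<Sum>j\<in>{0..n}. cartan (kind D) i j * int (mark D j)) = 0"
  "\<forall>j\<in>{0..n}. (\<Sum>i\<in>{0..n}. int (comark D i) * cartan (kind D) i j) = 0"
  "\<forall>i\<in>{0..n}. linear (coroot D i)"
  "\<forall>i\<in>{0..n}. \<forall>j\<in>{0..n}. coroot D i (sroot D j) = of_int (cartan (kind D) i j)"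
  "\<forall>i\<in>{0..n}. \<forall>j\<in>{0..n}. coroot D j (fundwt D i) = (if i = j then 1 else 0)"
  "span (insert (null_root D) (fundwt D ` {0..n})) = UNIV"
  "\<forall>\<mu>. linear (form D \<mu>)"
  "\<forall>\<mu> \<nu>. form D \<mu> \<nu> = form D \<nu> \<mu>"
  "form D (fundwt D 0) (fundwt D 0) = 0"
  "\<forall>i\<in>{0..n}. \<forall>j\<in>{0..n}. form D (sroot D i) (sroot D j) =
     real (comark D i) / real (mark D i) * of_int (cartan (kind D) i j)"
  "\<forall>i\<in>{0..n}. form D (sroot D i) (fundwt D 0) = (if i = 0 then 1 / real (mark D 0) else 0)"
  using datum unfolding is_affine_datum_def by - (elim conjE, assumption)+

lemma index_ball: "(\<forall>i\<in>{0..n}. P i) \<longleftrightarrow> (\<forall>i. i \<le> n \<longrightarrow> P i)"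
  by auto

lemmas valid = datum_conjuncts(1)
  and marks = datum_conjuncts(2)[unfolded index_ball, rule_format]
  and mark_gcd = datum_conjuncts(3,4)
  and mark_kernel = datum_conjuncts(5)[unfolded index_ball, rule_format]
  and comark_kernel = datum_conjuncts(6)[unfolded index_ball, rule_format]
  and coroot_linear = datum_conjuncts(7)[unfolded index_ball, rule_format]
  and coroot_sroot = datum_conjuncts(8)[unfolded index_ball, rule_format]
  and coroot_fundwt = datum_conjuncts(9)[unfolded index_ball, rule_format]
  and span_UNIV = datum_conjuncts(10)
  and form_linear = datum_conjuncts(11)[rule_format]
  and form_sym = datum_conjuncts(12)[rule_format]
  and form_00 = datum_conjuncts(13)
  and form_sroot = datum_conjuncts(14)[unfolded index_ball, rule_format]
  and form_sroot_0 = datum_conjuncts(15)[unfolded index_ball, rule_format]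

lemma sum_from_0: "sum g {0..n} = g 0 + sum g {1..n}"
  by (simp add: sum.atLeast_Suc_atMost)

lemma rank_kind: "rank (kind D) = n"
  by (simp add: rk_def)

lemma finite_J: "finite J"
  using index_J_range[OF valid not_A_even] finite_subset by blast

text \<open>The comarks are natural multiples of the comark at 0 by \<open>kernel_multiples\<close>,
  and a gcd of 1 forces that divisor to be 1.\<close>

lemma comark_J: "i \<in> J \<Longrightarrow> comark D i = 1"
  and comark_0: "comark D 0 = 1"
proof -
  have "col_sum (kind D) (\<lambda>i. real (comark D i)) j = 0" if "j \<le> rank (kind D)" for j
  proof -
    have "col_sum (kind D) (\<lambda>i. real (comark D i)) j
        = of_int (\<Sum>i\<in>{0..n}. int (comark D i) * cartan (kind D) i j)"
      by (simp add: col_sum_def rank_kind mult.commute)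
    then show ?thesis using comark_kernel that rank_kind by simp
  qed
  from kernel_multiples[OF valid not_A_even this] obtain k :: "nat \<Rightarrow> nat" where
    k: "\<And>i. i \<le> n \<Longrightarrow> real (comark D i) = real (k i) * real (comark D 0) \<and> (i \<in> J \<longrightarrow> k i = 1)"
    unfolding rank_kind by blast
  have ki: "comark D i = k i * comark D 0" if "i \<le> n" for i
    using k[OF that] by (metis of_nat_eq_iff of_nat_mult)
  have "comark D 0 dvd Gcd (comark D ` {0..n})"
  proof (rule Gcd_greatest)
    fix a assume "a \<in> comark D ` {0..n}"
    then obtain i where "i \<le> n" "a = comark D i" by auto
    then show "comark D 0 dvd a" using ki[of i] dvd_triv_right by metis
  qed
  then show 0: "comark D 0 = 1" using mark_gcd by simp
  show "comark D i = 1" if "i \<in> J" for i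
  proof -
    have "i \<le> n" using index_J_range[OF valid not_A_even] that rank_kind by auto
    then show ?thesis using k[of i] ki[of i] that 0 by simp
  qed
qed

text \<open>The rows annihilate the marks, hence so do the columns of the dual type. Only the value
  at 0 carries over, since \<open>index_J\<close> of the dual type is in general another
  set.\<close>

lemma mark_0: "mark D 0 = 1"
proof -
  let ?X = "dual_type (kind D)"
  note dual = valid_type_dual[OF valid not_A_even] rank_dual[OF valid not_A_even]
    dual_not_A_even[OF valid not_A_even]
  have "col_sum ?X (\<lambda>i. real (mark D i)) j = 0" if "j \<le> rank ?X" for j
  proof -
    have "col_sum ?X (\<lambda>i. real (mark D i)) j
        = of_int (\<Sum>i\<in>{0..n}. cartan (kind D) j i * int (mark D i))"
      by (simp add: col_sum_def rank_kind dual cartan_dual[OF valid not_A_even])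
    then show ?thesis using mark_kernel that rank_kind dual by simp
  qed
  from kernel_multiples[OF dual(1,3) this] obtain k :: "nat \<Rightarrow> nat" where
    k: "\<And>i. i \<le> n \<Longrightarrow> real (mark D i) = real (k i) * real (mark D 0)"
    unfolding dual rank_kind by blast
  have ki: "mark D i = k i * mark D 0" if "i \<le> n" for i
    using k[OF that] by (metis of_nat_eq_iff of_nat_mult)
  have "mark D 0 dvd Gcd (mark D ` {0..n})"
  proof (rule Gcd_greatest)
    fix a assume "a \<in> mark D ` {0..n}"
    then obtain i where "i \<le> n" "a = mark D i" by auto
    then show "mark D 0 dvd a" using ki[of i] dvd_triv_right by metis
  qed
  then show ?thesis using mark_gcd by simp
qed

section \<open>The projection to the finite part\<close>

lemma level_linear: "linear (level D)"
  unfolding level_def[abs_def]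
  by (rule linearI) (simp_all add: linear_add[OF coroot_linear] linear_scale[OF coroot_linear]
      sum.distrib sum_distrib_left algebra_simps)

lemma form_linear_left: "linear (\<lambda>\<mu>. form D \<mu> \<nu>)"
  by (rule linearI)
    (simp_all add: form_sym[of _ \<nu>] linear_add[OF form_linear] linear_scale[OF form_linear])

lemma proj_linear: "linear (proj D)"
  unfolding proj_def[abs_def]
  by (rule linearI) (simp_all add: linear_add[OF level_linear] linear_scale[OF level_linear]
      linear_add[OF form_linear_left] linear_scale[OF form_linear_left] algebra_simps)

lemma level_fundwt: "i \<le> n \<Longrightarrow> level D (fundwt D i) = real (comark D i)"
  by (simp add: level_def coroot_fundwt if_distrib cong: if_cong)

lemma level_sroot: "j \<le> n \<Longrightarrow> level D (sroot D j) = 0"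
proof -
  assume j: "j \<le> n"
  then have "level D (sroot D j) = of_int (\<Sum>i\<in>{0..n}. int (comark D i) * cartan (kind D) i j)"
    by (simp add: level_def coroot_sroot)
  then show ?thesis using comark_kernel[OF j] by simp
qed

lemma coroot_null_root: "i \<le> n \<Longrightarrow> coroot D i (null_root D) = 0"
proof -
  assume i: "i \<le> n"
  then have "coroot D i (null_root D) = of_int (\<Sum>j\<in>{0..n}. cartan (kind D) i j * int (mark D j))"
    by (simp add: null_root_def linear_sum[OF coroot_linear] linear_scale[OF coroot_linear]
        coroot_sroot mult.commute)
  then show ?thesis using mark_kernel[OF i] by simp
qed

lemma proj_fundwt_0: "w 0 = 0"
  by (simp add: proj_def level_fundwt comark_0 form_00)

lemma proj_null_root: "proj D (null_root D) = 0"
proof -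
  have "form D (null_root D) (fundwt D 0) = 1"
    by (simp add: null_root_def linear_sum[OF form_linear_left] linear_scale[OF form_linear_left]
        form_sroot_0 mark_0 if_distrib cong: if_cong)
  moreover have "level D (null_root D) = 0"
    by (simp add: level_def coroot_null_root)
  ultimately show ?thesis by (simp add: proj_def)
qed

lemma proj_sroot: "j \<in> {1..n} \<Longrightarrow> proj D (sroot D j) = sroot D j"
  by (simp add: proj_def level_sroot form_sroot_0)

text \<open>Up to a multiple of the null root, which the projection kills, a vector is determined by
  its coroot values. This turns projected simple roots into Cartan columns.\<close>

lemma proj_eq_weights: "proj D \<mu> = (\<Sum>i\<in>{0..n}. coroot D i \<mu> *\<^sub>R w i)"
proof (rule linear_eq_on[OF proj_linear])
  show "linear (\<lambda>\<mu>. \<Sum>i\<in>{0..n}. coroot D i \<mu> *\<^sub>R w i)"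
    by (rule linearI) (simp_all add: linear_add[OF coroot_linear] linear_scale[OF coroot_linear]
      sum.distrib scaleR_sum_right scaleR_add_left)
  show "\<mu> \<in> span (insert (null_root D) (fundwt D ` {0..n}))" using span_UNIV by simp
  fix b assume "b \<in> insert (null_root D) (fundwt D ` {0..n})"
  then show "proj D b = (\<Sum>i\<in>{0..n}. coroot D i b *\<^sub>R w i)"
  proof
    assume "b = null_root D"
    then show ?thesis by (simp add: proj_null_root coroot_null_root)
  next
    assume "b \<in> fundwt D ` {0..n}"
    then obtain i where i: "i \<le> n" "b = fundwt D i" by auto
    then have "(\<Sum>p\<in>{0..n}. coroot D p b *\<^sub>R w p) = (\<Sum>p\<in>{0..n}. if i = p then w p else 0)"
      by (intro sum.cong) (auto simp: coroot_fundwt)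
    then show ?thesis using i by simp
  qed
qed

lemma proj_sroot_col_sum: "j \<le> n \<Longrightarrow> proj D (sroot D j) = col_sum (kind D) (\<lambda>i. w i) j"
  by (simp add: proj_eq_weights[of "sroot D j"] col_sum_def rank_kind coroot_sroot)

lemma weight_residue:
  assumes "add_subgroup Q" "\<And>j. j \<in> {1..n} \<Longrightarrow> proj D (sroot D j) \<in> Q"
  shows "\<exists>i\<in>J. (\<Sum>p\<in>{0..n}. of_int (k p) *\<^sub>R w p) - w i \<in> Q"
  using residue_representative[OF valid not_A_even assms(1), of "\<lambda>i. w i" k] assms(2)
    proj_fundwt_0 by (simp add: rank_kind proj_sroot_col_sum)

text \<open>Some nonzero multiple of each projected weight lies in \<^term>\<open>h0_dual D\<close>, because there are
  only finitely many residues modulo this subspace.\<close>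

lemma proj_fundwt_h0:
  assumes p: "p \<le> n"
  shows "w p \<in> h0_dual D"
proof -
  let ?Q = "h0_dual D"
  have Q: "add_subgroup ?Q"
    by (auto simp: add_subgroup_def h0_dual_def span_zero span_diff)
  have sroot: "proj D (sroot D j) \<in> ?Q" if "j \<in> {1..n}" for j
    using that by (simp add: proj_sroot h0_dual_def span_base)
  have "\<exists>i\<in>J. real m *\<^sub>R w p - w i \<in> ?Q" for m
  proof -
    have "(\<Sum>q\<in>{0..n}. of_int (if q = p then int m
      else 0) *\<^sub>R w q) = (\<Sum>q\<in>{0..n}. if q = p then real m *\<^sub>R w q else 0)"
      by (intro sum.cong) auto
    then show ?thesis
      using weight_residue[OF Q sroot, of "\<lambda>q. if q = p then int m else 0"] p by simp
  qed
  then obtain g where g: "g m \<in> J" "real m *\<^sub>R w p - w (g m) \<in> ?Q" for m by metis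
  have "finite J" by (rule finite_J)
  then have "\<not> inj g"
    using g(1) finite_subset[of "range g" J] finite_imageD[of g UNIV] by auto
  then obtain a b where ab: "g a = g b" "a \<noteq> b" by (auto simp: inj_def)
  have "(real a - real b) *\<^sub>R w p \<in> ?Q"
    using add_subgroup_diff[OF Q g(2)[of a] g(2)[of b]] ab(1) by (simp add: algebra_simps)
  then have "(1 / (real a - real b)) *\<^sub>R (real a - real b) *\<^sub>R w p \<in> ?Q"
    unfolding h0_dual_def by (rule span_scale)
  then show ?thesis using ab(2) by simp
qed

lemma proj_in_h0: "proj D \<mu> \<in> h0_dual D"
  using proj_fundwt_h0 unfolding proj_eq_weights[of \<mu>] h0_dual_def
  by (intro span_sum span_scale) simp

text \<open>The null root projects to 0 and has coefficient 1 at \<open>\<alpha>\<^sub>0\<close>, so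
  the projected \<open>\<alpha>\<^sub>0\<close> is an integral combination of the others. With
  coefficient 2 it would only be half of one.\<close>

lemma proj_root_lattice: "proj D ` root_lattice D = Q0 D"
proof -
  have "proj D (null_root D) = (\<Sum>j\<in>{0..n}. real (mark D j) *\<^sub>R proj D (sroot D j))"
    by (simp add: null_root_def linear_sum[OF proj_linear] linear_scale[OF proj_linear])
  then have s0: "proj D (sroot D 0) = - (\<Sum>j\<in>{1..n}. real (mark D j) *\<^sub>R proj D (sroot D j))"
    by (simp add: proj_null_root sum_from_0 mark_0 eq_neg_iff_add_eq_0)
  have "proj D (\<Sum>j\<in>{0..n}. of_int (k j) *\<^sub>R sroot D j)
      = (\<Sum>j\<in>{1..n}. of_int (k j - k 0 * int (mark D j)) *\<^sub>R proj D (sroot D j))" for k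
    by (simp add: linear_sum[OF proj_linear] linear_scale[OF proj_linear] sum_from_0 s0
        linear_add[OF proj_linear] scaleR_diff_left sum_subtractf scaleR_sum_right)
  note eq = this
  show ?thesis
  proof (intro equalityI subsetI)
    fix x assume "x \<in> proj D ` root_lattice D"
    then obtain k where "x = proj D (\<Sum>j\<in>{0..n}. of_int (k j) *\<^sub>R sroot D j)"
      by (auto simp: root_lattice_def int_span_def)
    then show "x \<in> Q0 D" by (simp only: eq Q0_def int_spanI)
  next
    fix x assume "x \<in> Q0 D"
    then obtain k where k: "x = (\<Sum>j\<in>{1..n}. of_int (k j) *\<^sub>R proj D (sroot D j))"
      by (auto simp: Q0_def int_span_def)
    have "x = proj D (\<Sum>j\<in>{0..n}. of_int ((k(0 := 0)) j) *\<^sub>R sroot D j)"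
      unfolding eq k by (intro sum.cong) auto
    then show "x \<in> proj D ` root_lattice D"
      unfolding root_lattice_def by (rule image_eqI) (rule int_spanI)
  qed
qed

lemma add_subgroup_Q0: "add_subgroup (Q0 D)"
  by (simp add: Q0_def add_subgroup_int_span)

text \<open>The numbers of \<open>residue_separation\<close> become a functional \<open>F\<close> by
  pairing with the finite coroots: it has value \<open>f p\<close> on \<open>w p\<close> and is
  integral on \<open>Q0 D\<close>.\<close>

lemma weights_inequivalent:
  assumes "i \<in> J" "i' \<in> J" "i \<noteq> i'"
  shows "w i - w i' \<notin> Q0 D"
proof
  assume Q0: "w i - w i' \<in> Q0 D"
  obtain f :: "nat \<Rightarrow> real" where f: "f 0 = 0" "f i - f i' \<notin> \<int>"
    "\<And>j. j \<in> {1..n} \<Longrightarrow> col_sum (kind D) f j \<in> \<int>"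
    using residue_separation[OF valid not_A_even assms] unfolding rank_kind by blast
  define F where "F \<mu> = (\<Sum>p\<in>{1..n}. f p * coroot D p \<mu>)" for \<mu>
  have lin: "linear F"
    unfolding F_def
      by (rule linearI) (simp_all add: linear_add[OF coroot_linear] linear_scale[OF coroot_linear]
      sum.distrib sum_distrib_left algebra_simps)
  have Fw: "F (w p) = f p" if "p \<le> n" for p
  proof -
    have "coroot D q (w p) = (if p = q then 1 else 0)" if "q \<in> {1..n}" for q
      using that \<open>p \<le> n\<close>
        by (simp add: proj_def linear_diff[OF coroot_linear] linear_scale[OF coroot_linear]
          coroot_fundwt coroot_null_root)
    then have "F (w p) = (\<Sum>q\<in>{1..n}. if p = q then f q else 0)"
      unfolding F_def by (intro sum.cong) auto
    then show ?thesis using that f(1) by (cases "p = 0") auto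
  qed
  have Fr: "F (proj D (sroot D j)) \<in> \<int>" if "j \<in> {1..n}" for j
  proof -
    have "F (proj D (sroot D j)) = (\<Sum>p\<in>{0..n}. of_int (cartan (kind D) p j) *\<^sub>R f p)"
      using that f(1) by (simp add: proj_sroot F_def coroot_sroot sum_from_0 mult.commute)
    then show ?thesis using f(3)[OF that] by (simp add: col_sum_def rank_kind)
  qed
  from Q0 obtain k :: "nat \<Rightarrow> int" where "w i - w i'
    = (\<Sum>j\<in>{1..n}. of_int (k j) *\<^sub>R proj D (sroot D j))"
    by (auto simp: Q0_def int_span_def)
  then have "F (w i - w i') = (\<Sum>j\<in>{1..n}. of_int (k j) * F (proj D (sroot D j)))"
    by (simp add: linear_sum[OF lin] linear_scale[OF lin])
  also have "\<dots> \<in> \<int>" using Fr by (intro Ints_sum Ints_mult) auto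
  finally show False
    using f(2) Fw assms index_J_range[OF valid not_A_even]
    by (auto simp: linear_diff[OF lin] rank_kind subset_iff)
qed

section \<open>The alcove and the sieving relation\<close>

lemma form_sroot_h0:
  assumes "\<mu> \<in> h0_dual D" "j \<in> {1..n}"
  shows "form D \<mu> (sroot D j) = real (comark D j) / real (mark D j) * coroot D j \<mu>"
proof (rule linear_eq_on[OF form_linear_left])
  show "linear (\<lambda>\<mu>. real (comark D j) / real (mark D j) * coroot D j \<mu>)"
    using assms(2)
      by (intro linearI)
        (simp_all add: linear_add[OF coroot_linear]
          linear_scale[OF coroot_linear] algebra_simps add_divide_distrib)
  show "\<mu> \<in> span (sroot D ` {1..n})" using assms(1) by (simp add: h0_dual_def)
  fix b assume "b \<in> sroot D ` {1..n}"
  then show "form D b (sroot D j) = real (comark D j) / real (mark D j) * coroot D j b"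
    using assms(2) by (auto simp: form_sym[of _ "sroot D j"] form_sroot coroot_sroot)
qed

text \<open>The marks in \<open>theta D\<close> cancel the denominators of
  \<open>form_sroot_h0\<close>. The wall inequality thus bounds the part of the level that comes
  from the finite coroots.\<close>

lemma form_theta:
  assumes "\<mu> \<in> h0_dual D"
  shows "form D \<mu> (theta D) = (\<Sum>j\<in>{1..n}. real (comark D j) * coroot D j \<mu>)"
proof -
  have "theta D = (\<Sum>j\<in>{1..n}. real (mark D j) *\<^sub>R sroot D j)"
    by (simp add: theta_def null_root_def sum_from_0)
  then have "form D \<mu> (theta D) = (\<Sum>j\<in>{1..n}. real (mark D j) * form D \<mu> (sroot D j))"
    by (simp add: linear_sum[OF form_linear] linear_scale[OF form_linear])
  also have "\<dots> = (\<Sum>j\<in>{1..n}. real (comark D j) * coroot D j \<mu>)"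
    using marks by (intro sum.cong) (simp_all add: form_sroot_h0[OF assms])
  finally show ?thesis .
qed

text \<open>Projecting keeps the finite coroot values, so the wall inequality reads
  \<open>l - m 0 \<le> l\<close>: the coefficient at node 0 is the slack.\<close>

lemma proj_Pcl:
  assumes "\<Lambda> \<in> Pcl D l"
  shows "proj D \<Lambda> \<in> alcove D l" and "\<exists>k :: nat \<Rightarrow> int. proj D \<Lambda> = (\<Sum>p\<in>{0..n}. of_int (k p) *\<^sub>R w p)"
proof -
  obtain m :: "nat \<Rightarrow> nat" where m: "\<Lambda> = (\<Sum>i\<in>{0..n}. real (m i) *\<^sub>R fundwt D i)"
    "(\<Sum>i\<in>{0..n}. comark D i * m i) = l"
    using assms by (auto simp: Pcl_def)
  have pr: "proj D \<Lambda> = (\<Sum>p\<in>{0..n}. real (m p) *\<^sub>R w p)"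
    by (simp add: m(1) linear_sum[OF proj_linear] linear_scale[OF proj_linear])
  show "\<exists>k :: nat \<Rightarrow> int. proj D \<Lambda> = (\<Sum>p\<in>{0..n}. of_int (k p) *\<^sub>R w p)"
    unfolding pr by (intro exI[of _ "\<lambda>p. int (m p)"]) simp
  have "coroot D j \<Lambda> = (\<Sum>i\<in>{0..n}. if i = j then real (m i) else 0)" if "j \<le> n" for j
    unfolding m(1) linear_sum[OF coroot_linear[OF that]] using that
    by (intro sum.cong) (auto simp: linear_scale[OF coroot_linear] coroot_fundwt)
  then have coL: "coroot D j \<Lambda> = real (m j)" if "j \<le> n" for j using that by simp
  have co: "coroot D j (proj D \<Lambda>) = real (m j)" if "j \<in> {1..n}" for j
    using that by (simp add: proj_def linear_diff[OF coroot_linear] linear_scale[OF coroot_linear]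
          coroot_fundwt coroot_null_root coL)
  have "(\<Sum>i\<in>{1..n}. comark D i * m i) \<le> l"
    unfolding m(2)[symmetric] by (intro sum_mono2) auto
  then have "(\<Sum>j\<in>{1..n}. real (comark D j) * real (m j)) \<le> real l"
    by (metis (no_types, lifting) of_nat_le_iff of_nat_mult of_nat_sum sum.cong)
  then have "form D (proj D \<Lambda>) (theta D) \<le> real l"
    by (simp add: form_theta[OF proj_in_h0] co)
  then show "proj D \<Lambda> \<in> alcove D l"
    using co by (simp add: alcove_def proj_in_h0)
qed

lemma coset_subset:
  assumes Q: "add_subgroup Q" and "x - y \<in> Q"
  shows "(\<lambda>q. x + q) ` Q \<subseteq> (\<lambda>q. y + q) ` Q"
proof
  fix z assume "z \<in> (\<lambda>q. x + q) ` Q"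
  then obtain q where "q \<in> Q" "z = x + q" by auto
  then have "z = y + ((x - y) + q)" "(x - y) + q \<in> Q" using add_subgroup_add[OF Q assms(2)] by auto
  then show "z \<in> (\<lambda>q. y + q) ` Q" by blast
qed

text \<open>Intersecting with the alcove loses nothing: \<open>proj D \<Lambda>\<close> lies in the
  alcove and in its own coset, so equal intersections put it into the other coset too.\<close>

lemma sieving_iff:
  assumes "\<Lambda> \<in> Pcl D l" "\<Lambda>' \<in> Pcl D l"
  shows "(\<Lambda>, \<Lambda>') \<in> sieving D l \<longleftrightarrow> proj D \<Lambda> - proj D \<Lambda>' \<in> Q0 D"
proof
  assume "(\<Lambda>, \<Lambda>') \<in> sieving D l"
  then have eq: "alcove D l \<inter> (\<lambda>q. proj D \<Lambda> + q) ` Q0 D = alcove D l \<inter> (\<lambda>q. proj D \<Lambda>' + q) ` Q0 D"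
    by (simp add: sieving_def proj_root_lattice)
  have "proj D \<Lambda> \<in> alcove D l \<inter> (\<lambda>q. proj D \<Lambda> + q) ` Q0 D"
    using proj_Pcl(1)[OF assms(1)] add_subgroup_zero[OF add_subgroup_Q0]
    by (auto intro!: image_eqI[of _ _ 0])
  then obtain q where "q \<in> Q0 D" "proj D \<Lambda> = proj D \<Lambda>' + q" unfolding eq by auto
  then show "proj D \<Lambda> - proj D \<Lambda>' \<in> Q0 D" by simp
next
  assume d: "proj D \<Lambda> - proj D \<Lambda>' \<in> Q0 D"
  have "(\<lambda>q. proj D \<Lambda> + q) ` Q0 D = (\<lambda>q. proj D \<Lambda>' + q) ` Q0 D"
    using coset_subset[OF add_subgroup_Q0 d] coset_subset[OF add_subgroup_Q0
      add_subgroup_sym[OF add_subgroup_Q0 d]]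
    by blast
  then show "(\<Lambda>, \<Lambda>') \<in> sieving D l"
    using assms by (simp add: sieving_def proj_root_lattice)
qed

section \<open>Representatives of the two quotients\<close>

abbreviation "dr l i \<equiv> (real l - 1) *\<^sub>R fundwt D 0 + fundwt D i"

lemma proj_dr: "proj D (dr l i) = w i"
  by (simp add: linear_add[OF proj_linear] linear_scale[OF proj_linear] proj_fundwt_0)

lemma J_range: "i \<in> J \<Longrightarrow> i \<le> n"
  using index_J_range[OF valid not_A_even] by (auto simp: rank_kind)

lemma dr_Pcl:
  assumes l: "1 \<le> l \<or> J = {0}" and i: "i \<in> J"
  shows "dr l i \<in> Pcl D l"
proof -
  \<comment> \<open>For \<open>i = 0\<close> both summands fall on node 0 and give \<open>l\<close>,
    which is right even for \<open>l = 0\<close>; otherwise \<open>l - 1\<close> must not be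
    truncated, hence the hypothesis.\<close>
  define m where "m p = (if p = 0 then if i = 0 then l else l - 1 else if p = i then 1
    else 0)" for p
  have s1: "(\<Sum>p\<in>{1..n}. real (m p) *\<^sub>R fundwt D p) = (\<Sum>p\<in>{1..n}. if p = i then fundwt D p else 0)"
    and s2: "(\<Sum>p\<in>{1..n}. comark D p * m p) = (\<Sum>p\<in>{1..n}. if p = i then comark D p else 0)"
    by (intro sum.cong; simp add: m_def)+
  have "dr l i = (\<Sum>p\<in>{0..n}. real (m p) *\<^sub>R fundwt D p) \<and> (\<Sum>p\<in>{0..n}. comark D p * m p) = l"
  proof (cases "i = 0")
    case True
    then have "m 0 = l" by (simp add: m_def)
    then show ?thesis unfolding sum_from_0 using s1 s2 True comark_0 by (simp add: scaleR_diff_left)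
  next
    case False
    have "1 \<le> l" using l
    proof
      assume "J = {0}"
      then have "i \<in> {0}" using i by simp
      then show ?thesis using False by simp
    qed
    then have "m 0 = l - 1" "real (m 0) = real l - 1" using False by (simp_all add: m_def)
    then show ?thesis
      unfolding sum_from_0 using s1 s2 False J_range[OF i] comark_0 comark_J[OF i] \<open>1 \<le> l\<close> by simp
  qed
  then show ?thesis unfolding Pcl_def by blast
qed

lemma DR_eq: "DR D l = dr l ` J"
  by (auto simp: DR_def)

lemma representatives_Pcl:
  assumes l: "1 \<le> l \<or> J = {0}"
  shows "complete_representatives (Pcl D l) (sieving D l) (DR D l)"
  unfolding complete_representatives_def
proof (intro conjI ballI impI)
  show "DR D l \<subseteq> Pcl D l" using dr_Pcl[OF l] by (auto simp: DR_eq)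
next
  fix \<Lambda> assume L: "\<Lambda> \<in> Pcl D l"
  then obtain k :: "nat \<Rightarrow> int" where k: "proj D \<Lambda> = (\<Sum>p\<in>{0..n}. of_int (k p) *\<^sub>R w p)"
    using proj_Pcl(2) by blast
  obtain i where i: "i \<in> J" "proj D \<Lambda> - w i \<in> Q0 D"
    using weight_residue[OF add_subgroup_Q0, of k] int_span_base[of "{1..n}" _ "\<lambda>j. proj D (sroot D j)"]
    unfolding k Q0_def by auto
  then have "(\<Lambda>, dr l i) \<in> sieving D l"
    using sieving_iff[OF L dr_Pcl[OF l i(1)]] by (simp add: proj_dr)
  then show "\<exists>y\<in>DR D l. (\<Lambda>, y) \<in> sieving D l" using i(1) by (auto simp: DR_eq)
next
  fix x y assume "x \<in> DR D l" "y \<in> DR D l" and ne: "x \<noteq> y"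
  then obtain i i' where i: "i \<in> J" "i' \<in> J" "x = dr l i" "y = dr l i'" by (auto simp: DR_eq)
  then have "i \<noteq> i'" using ne by auto
  then show "(x, y) \<notin> sieving D l"
    using sieving_iff[OF dr_Pcl[OF l i(1)] dr_Pcl[OF l i(2)]] weights_inequivalent[OF i(1,2)] i
    by (simp add: proj_dr)
qed

lemma weights_distinct:
  assumes "i \<in> J" "i' \<in> J" "w i = w i'"
  shows "i = i'"
  using weights_inequivalent[OF assms(1,2)] assms(3) add_subgroup_zero[OF add_subgroup_Q0] by auto

lemma card_DR: "card (DR D l) = card J"
  unfolding DR_eq by (rule card_image, rule inj_onI) (metis proj_dr weights_distinct)

abbreviation "Q0_rel \<equiv> {(x, y). x \<in> P0 D \<and> y \<in> P0 D \<and> x - y \<in> Q0 D}"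

lemma equiv_Q0_rel: "equiv (P0 D) Q0_rel"
proof (rule equivI)
  show "Q0_rel \<subseteq> P0 D \<times> P0 D" by auto
  show "refl_on (P0 D) Q0_rel"
    by (auto simp: refl_on_def add_subgroup_zero[OF add_subgroup_Q0])
  show "sym Q0_rel"
    using add_subgroup_sym[OF add_subgroup_Q0] by (auto simp: sym_def)
  show "trans Q0_rel"
    using add_subgroup_trans[OF add_subgroup_Q0] by (auto simp: trans_def)
qed

lemma weight_P0:
  assumes "i \<le> n"
  shows "w i \<in> P0 D"
proof (cases "i = 0")
  case True
  then show ?thesis
    using add_subgroup_zero[OF add_subgroup_int_span] by (simp add: proj_fundwt_0 P0_def)
qed (use assms int_span_base[of "{1..n}" i "\<lambda>i. w i"] in \<open>simp add: P0_def\<close>)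

text \<open>These are the projections of the elements of \<open>DR D l\<close>, whatever
  \<open>l\<close> is. Both quotients are therefore counted by \<open>J\<close>, and no determinant
  is computed.\<close>

lemma representatives_P0: "complete_representatives (P0 D) Q0_rel ((\<lambda>i. w i) ` J)"
  unfolding complete_representatives_def
proof (intro conjI ballI impI)
  show "(\<lambda>i. w i) ` J \<subseteq> P0 D" using weight_P0 J_range by auto
next
  fix x assume x: "x \<in> P0 D"
  then obtain k :: "nat \<Rightarrow> int" where "x = (\<Sum>p\<in>{1..n}. of_int (k p) *\<^sub>R w p)"
    by (auto simp: P0_def int_span_def)
  then have k: "x = (\<Sum>p\<in>{0..n}. of_int (k p) *\<^sub>R w p)"
    by (simp add: sum_from_0 proj_fundwt_0)
  obtain i where i: "i \<in> J" "x - w i \<in> Q0 D"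
    using weight_residue[OF add_subgroup_Q0, of k] int_span_base[of "{1..n}" _ "\<lambda>j. proj D (sroot D j)"]
    unfolding k Q0_def by auto
  then show "\<exists>y\<in>(\<lambda>i. w i) ` J. (x, y) \<in> Q0_rel" using x weight_P0[OF J_range[OF i(1)]] by blast
next
  fix x y assume "x \<in> (\<lambda>i. w i) ` J" "y \<in> (\<lambda>i. w i) ` J" and ne: "x \<noteq> y"
  then obtain i i' where i: "i \<in> J" "i' \<in> J" "x = w i" "y = w i'" by blast
  then have "i \<noteq> i'" using ne by blast
  then show "(x, y) \<notin> Q0_rel" using weights_inequivalent[OF i(1,2)] i(3,4) by blast
qed

lemma card_weights: "card ((\<lambda>i. w i) ` J) = card J"
  by (rule card_image, rule inj_onI) (rule weights_distinct)

end

theorem lemma2p4: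
  fixes D :: "'v::real_vector affine_datum" and l :: nat
  assumes "is_affine_datum D"
    and "\<nexists>n. kind D = Tw_A_even n"
    and "1 \<le> l \<or> index_J (kind D) = {0}"
  shows "complete_representatives (Pcl D l) (sieving D l) (DR D l)
       \<and> finite (Pcl D l // sieving D l)
       \<and> finite (P0_mod_Q0 D)
       \<and> card (Pcl D l // sieving D l) = card (P0_mod_Q0 D)"
proof -
  interpret affine_lattice D using assms by unfold_locales
  have fin: "finite (DR D l)" "finite ((\<lambda>i. proj D (fundwt D i)) ` index_J (kind D))"
    using finite_J by (simp_all add: DR_eq)
  show ?thesis
    using representatives_Pcl[OF assms(3)]
      quotient_card_representatives[OF equiv_sieving representatives_Pcl[OF assms(3)] fin(1)]
      quotient_card_representatives[OF equiv_Q0_rel representatives_P0 fin(2)]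
    by (simp add: card_DR card_weights P0_mod_Q0_def)
qed

end
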